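(* For every integer $m\geq1$ and every odd dimension $2n+1$ there exists a compact $b^m$-contact manifold $(M,\alpha)$ of dimension $2n+1$, with non-empty critical hypersurface $Z$, whose Reeb vector field has no periodic orbits on $M\setminus Z$.
   Context: Manifolds here are without boundary. Let $M$ be a manifold with a hypersurface $Z=z^{-1}(0)$, where $z:M\to\mathbb{R}$ is a global defining function ($dz\neq0$ along $Z$). A $b^m$-vector field is a smooth vector field $v$ with $v(z)\in z^mC^\infty(M)$. These are the sections of a vector bundle ${}^{b^m}TM$, locally spanned by $z^m\partial_z$ and the coordinate fields along $Z$. A $b^m$-form of degree $k$ is a section of $\Lambda^k({}^{b^m}TM)^*$; it can be written $\frac{dz}{z^m}\wedge\eta+\beta$ with $\eta,\beta$ smooth forms. The exterior derivative is the extension of the usual one on $M\setminus Z$. On $M^{2n+1}$, a $b^m$-contact form is a $b^m$-form $\alpha$ of degree 1 with $\alpha\wedge(d\alpha)^n\neq0$ everywhere as a section of $\Lambda^{2n+1}({}^{b^m}TM)^*$; $(M,\alpha)$ is then a $b^m$-contact manifold and $Z$ its critical hypersurface (critical set). The Reeb vector field $R_\alpha$ is the unique $b^m$-vector field with $\iota_{R_\alpha}d\alpha=0$, $\alpha(R_\alpha)=1$. *)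

theory Defs
  imports "HOL-Analysis.Analysis"
begin

section \<open>Smooth manifolds\<close>

text \<open>For open \<open>S\<close>, \<open>Ck_on k S f\<close> says that \<open>f\<close> is \<open>k\<close> times continuously differentiable on \<open>S\<close>.\<close>

fun Ck_on ::
  "nat \<Rightarrow> 'e::euclidean_space set \<Rightarrow> ('e \<Rightarrow> 'f::real_normed_vector) \<Rightarrow> bool" where
  "Ck_on 0 S f \<longleftrightarrow> continuous_on S f"
| "Ck_on (Suc k) S f \<longleftrightarrow>
     (\<forall>x\<in>S. f differentiable (at x)) \<and>
     (\<forall>v. Ck_on k S (\<lambda>x. frechet_derivative f (at x) v))"

definition smooth_on ::
  "'e::euclidean_space set \<Rightarrow> ('e \<Rightarrow> 'f::real_normed_vector) \<Rightarrow> bool" where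
  "smooth_on S f \<longleftrightarrow> (\<forall>k. Ck_on k S f)"

text \<open>A chart is a pair of a domain and a coordinate map with values in the Euclidean
  space \<open>'e\<close>; the values of the coordinate map off the domain are irrelevant.\<close>

type_synonym ('a, 'e) chart = "'a set \<times> ('a \<Rightarrow> 'e)"

definition param :: "('a, 'e) chart \<Rightarrow> 'e \<Rightarrow> 'a" where
  "param c = inv_into (fst c) (snd c)"

definition transition :: "('a, 'e) chart \<Rightarrow> ('a, 'e) chart \<Rightarrow> 'e \<Rightarrow> 'e" where
  "transition c d = snd d \<circ> param c"

definition smooth_manifold ::
  "'a topology \<Rightarrow> ('a, 'e::euclidean_space) chart set \<Rightarrow> bool" where
  "smooth_manifold M A \<longleftrightarrow>
     Hausdorff_space M \<and> second_countable M \<and>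
     (\<Union>c\<in>A. fst c) = topspace M \<and>
     (\<forall>c\<in>A. openin M (fst c) \<and> open (snd c ` fst c) \<and>
        homeomorphic_map (subtopology M (fst c)) (top_of_set (snd c ` fst c)) (snd c)) \<and>
     (\<forall>c\<in>A. \<forall>d\<in>A. smooth_on (snd c ` (fst c \<inter> fst d)) (transition c d))"

definition smooth_funs ::
  "('a, 'e::euclidean_space) chart set \<Rightarrow> ('a \<Rightarrow> real) set" where
  "smooth_funs A = {f. \<forall>c\<in>A. smooth_on (snd c ` fst c) (f \<circ> param c)}"

section \<open>Vector fields and differential forms\<close>

text \<open>A vector field is given by its local representatives, one for each chart; the
  representative in \<open>c\<close> is a vector-valued function on the open set \<open>snd c ` fst c\<close>, and the
  representatives are related by the derivatives of the transition maps.\<close>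

type_synonym ('a, 'e) vfield = "('a, 'e) chart \<Rightarrow> 'e \<Rightarrow> 'e"

definition vector_field ::
  "('a, 'e::euclidean_space) chart set \<Rightarrow> ('a, 'e) vfield \<Rightarrow> bool" where
  "vector_field A v \<longleftrightarrow>
     (\<forall>c\<in>A. smooth_on (snd c ` fst c) (v c)) \<and>
     (\<forall>c\<in>A. \<forall>d\<in>A. \<forall>p\<in>fst c \<inter> fst d.
        v d (snd d p) = frechet_derivative (transition c d) (at (snd c p)) (v c (snd c p)))"

text \<open>An alternating \<open>k\<close>-linear map takes a sequence of vectors as its argument and depends
  only on the first \<open>k\<close> of them.\<close>

definition alternating ::
  "nat \<Rightarrow> ((nat \<Rightarrow> 'e::real_vector) \<Rightarrow> real) \<Rightarrow> bool" where
  "alternating k \<omega> \<longleftrightarrow>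
     (\<forall>v w. (\<forall>i<k. v i = w i) \<longrightarrow> \<omega> v = \<omega> w) \<and>
     (\<forall>i<k. \<forall>v. linear (\<lambda>a. \<omega> (v(i := a)))) \<and>
     (\<forall>i j v. i < j \<and> j < k \<and> v i = v j \<longrightarrow> \<omega> v = 0)"

text \<open>Wedge product of an alternating \<open>k\<close>-linear and an alternating \<open>l\<close>-linear map, normalised
  so that \<open>dx\<^sub>1 \<and> \<dots> \<and> dx\<^sub>k\<close> is the determinant.\<close>

definition wedge ::
  "nat \<Rightarrow> nat \<Rightarrow> ((nat \<Rightarrow> 'e) \<Rightarrow> real) \<Rightarrow> ((nat \<Rightarrow> 'e) \<Rightarrow> real) \<Rightarrow> (nat \<Rightarrow> 'e) \<Rightarrow> real" where
  "wedge k l \<omega> \<eta> v =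
     (\<Sum>\<sigma> | \<sigma> permutes {..<k + l}.
        of_int (sign \<sigma>) * \<omega> (\<lambda>i. v (\<sigma> i)) * \<eta> (\<lambda>i. v (\<sigma> (k + i)))) / (fact k * fact l)"

fun wedge_power ::
  "nat \<Rightarrow> ((nat \<Rightarrow> 'e) \<Rightarrow> real) \<Rightarrow> nat \<Rightarrow> (nat \<Rightarrow> 'e) \<Rightarrow> real" where
  "wedge_power k \<omega> 0 = (\<lambda>v. 1)"
| "wedge_power k \<omega> (Suc n) = wedge k (k * n) \<omega> (wedge_power k \<omega> n)"

text \<open>Like vector fields, differential forms are given by their local representatives.  Only
  the restriction of \<open>\<omega> c\<close> to \<open>snd c ` (fst c \<inter> S)\<close> matters for a form on the open set \<open>S\<close>.\<close>

type_synonym ('a, 'e) form = "('a, 'e) chart \<Rightarrow> 'e \<Rightarrow> (nat \<Rightarrow> 'e) \<Rightarrow> real"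

definition form_on ::
  "('a, 'e::euclidean_space) chart set \<Rightarrow> 'a set \<Rightarrow> nat \<Rightarrow> ('a, 'e) form \<Rightarrow> bool" where
  "form_on A S k \<omega> \<longleftrightarrow>
     (\<forall>c\<in>A. (\<forall>x\<in>snd c ` (fst c \<inter> S). alternating k (\<omega> c x)) \<and>
        (\<forall>v. smooth_on (snd c ` (fst c \<inter> S)) (\<lambda>x. \<omega> c x v))) \<and>
     (\<forall>c\<in>A. \<forall>d\<in>A. \<forall>p\<in>fst c \<inter> fst d \<inter> S. \<forall>v.
        \<omega> c (snd c p) v =
        \<omega> d (snd d p) (\<lambda>i. frechet_derivative (transition c d) (at (snd c p)) (v i)))"

text \<open>The invariant formula for \<open>d\<omega>\<close>, evaluated on coordinate vector fields, which commute;
  \<open>v\<close> with its \<open>i\<close>-th entry omitted is passed to \<open>\<omega>\<close>.\<close>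

definition ext_deriv ::
  "nat \<Rightarrow> ('a, 'e::euclidean_space) form \<Rightarrow> ('a, 'e) form" where
  "ext_deriv k \<omega> c x v =
     (\<Sum>i\<le>k. (-1) ^ i *
        frechet_derivative (\<lambda>y. \<omega> c y (\<lambda>j. if j < i then v j else v (Suc j))) (at x) (v i))"

section \<open>\<open>b\<^sup>m\<close>-geometry\<close>

definition critical_set :: "'a topology \<Rightarrow> ('a \<Rightarrow> real) \<Rightarrow> 'a set" where
  "critical_set M z = {p \<in> topspace M. z p = 0}"

definition defining_function ::
  "'a topology \<Rightarrow> ('a, 'e::euclidean_space) chart set \<Rightarrow> ('a \<Rightarrow> real) \<Rightarrow> bool" where
  "defining_function M A z \<longleftrightarrow>
     z \<in> smooth_funs A \<and>
     (\<forall>c\<in>A. \<forall>p\<in>fst c \<inter> critical_set M z.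
        frechet_derivative (z \<circ> param c) (at (snd c p)) \<noteq> (\<lambda>_. 0))"

definition bm_vector_field ::
  "('a, 'e::euclidean_space) chart set \<Rightarrow> ('a \<Rightarrow> real) \<Rightarrow> nat \<Rightarrow> ('a, 'e) vfield \<Rightarrow> bool" where
  "bm_vector_field A z m v \<longleftrightarrow>
     vector_field A v \<and>
     (\<exists>g\<in>smooth_funs A. \<forall>c\<in>A. \<forall>p\<in>fst c.
        frechet_derivative (z \<circ> param c) (at (snd c p)) (v c (snd c p)) = z p ^ m * g p)"

text \<open>The complement of the critical set is dense, and the \<open>b\<^sup>m\<close>-tangent bundle restricts to
  the tangent bundle there.  So a section of the \<open>k\<close>-th exterior power of the \<open>b\<^sup>m\<close>-cotangent
  bundle is determined by an ordinary \<open>k\<close>-form on the complement, and such a form \<open>\<omega>\<close> comes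
  from a section iff \<open>\<omega>(v\<^sub>0, \<dots>, v\<^sub>k\<^sub>-\<^sub>1)\<close> extends to a smooth function on the whole manifold
  for all sections \<open>v\<^sub>i\<close> of the \<open>b\<^sup>m\<close>-tangent bundle.  We represent \<open>b\<^sup>m\<close>-forms by these
  ordinary forms; the values of a representative on the critical set are irrelevant.
  Wedge products and exterior derivatives of \<open>b\<^sup>m\<close>-forms are then the ordinary ones off
  the critical set.\<close>

text \<open>\<open>g\<close> is the pairing of the \<open>b\<^sup>m\<close>-form \<open>\<omega>\<close> with \<open>v\<^sub>0, v\<^sub>1, \<dots>\<close>, as a smooth function on the
  whole manifold.\<close>

definition bm_pairing ::
  "('a, 'e::euclidean_space) chart set \<Rightarrow> ('a \<Rightarrow> real) \<Rightarrow> ('a, 'e) form \<Rightarrow>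
   (nat \<Rightarrow> ('a, 'e) vfield) \<Rightarrow> ('a \<Rightarrow> real) \<Rightarrow> bool" where
  "bm_pairing A z \<omega> v g \<longleftrightarrow>
     g \<in> smooth_funs A \<and>
     (\<forall>c\<in>A. \<forall>p\<in>fst c. z p \<noteq> 0 \<longrightarrow> g p = \<omega> c (snd c p) (\<lambda>i. v i c (snd c p)))"

definition bm_form ::
  "'a topology \<Rightarrow> ('a, 'e::euclidean_space) chart set \<Rightarrow> ('a \<Rightarrow> real) \<Rightarrow> nat \<Rightarrow> nat \<Rightarrow>
   ('a, 'e) form \<Rightarrow> bool" where
  "bm_form M A z m k \<omega> \<longleftrightarrow>
     form_on A (topspace M - critical_set M z) k \<omega> \<and>
     (\<forall>v. (\<forall>i<k. bm_vector_field A z m (v i)) \<longrightarrow> (\<exists>g. bm_pairing A z \<omega> v g))"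

text \<open>The fibre at \<open>p\<close> of the \<open>b\<^sup>m\<close>-tangent bundle consists of the values at \<open>p\<close> of its sections,
  so a \<open>b\<^sup>m\<close>-form of degree \<open>k\<close> is nonzero at \<open>p\<close>, as an alternating form on the fibre, iff
  its pairing with some \<open>k\<close> sections is nonzero at \<open>p\<close>.  On the critical set this differs
  from being nonzero as an ordinary form.\<close>

definition bm_nonzero_at ::
  "('a, 'e::euclidean_space) chart set \<Rightarrow> ('a \<Rightarrow> real) \<Rightarrow> nat \<Rightarrow> nat \<Rightarrow>
   ('a, 'e) form \<Rightarrow> 'a \<Rightarrow> bool" where
  "bm_nonzero_at A z m k \<omega> p \<longleftrightarrow>
     (\<exists>v g. (\<forall>i<k. bm_vector_field A z m (v i)) \<and> bm_pairing A z \<omega> v g \<and> g p \<noteq> 0)"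

definition contact_volume ::
  "nat \<Rightarrow> ('a, 'e::euclidean_space) form \<Rightarrow> ('a, 'e) form" where
  "contact_volume n \<alpha> c x =
     wedge 1 (2 * n) (\<alpha> c x) (wedge_power 2 (ext_deriv 1 \<alpha> c x) n)"

definition bm_contact_manifold ::
  "'a topology \<Rightarrow> ('a, 'e::euclidean_space) chart set \<Rightarrow> ('a \<Rightarrow> real) \<Rightarrow> nat \<Rightarrow> nat \<Rightarrow>
   ('a, 'e) form \<Rightarrow> bool" where
  "bm_contact_manifold M A z m n \<alpha> \<longleftrightarrow>
     DIM('e) = 2 * n + 1 \<and>
     smooth_manifold M A \<and>
     defining_function M A z \<and>
     bm_form M A z m 1 \<alpha> \<and>
     (\<forall>p\<in>topspace M. bm_nonzero_at A z m (2 * n + 1) (contact_volume n \<alpha>) p)"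

text \<open>Both equations are equations between \<open>b\<^sup>m\<close>-forms, hence are required off the critical
  set only.  For a \<open>b\<^sup>m\<close>-contact manifold they determine \<open>R\<close> uniquely.\<close>

definition reeb_field ::
  "('a, 'e::euclidean_space) chart set \<Rightarrow> ('a \<Rightarrow> real) \<Rightarrow> nat \<Rightarrow> ('a, 'e) form \<Rightarrow>
   ('a, 'e) vfield \<Rightarrow> bool" where
  "reeb_field A z m \<alpha> R \<longleftrightarrow>
     bm_vector_field A z m R \<and>
     (\<forall>c\<in>A. \<forall>p\<in>fst c. z p \<noteq> 0 \<longrightarrow>
        \<alpha> c (snd c p) (\<lambda>_. R c (snd c p)) = 1 \<and>
        (\<forall>w. ext_deriv 1 \<alpha> c (snd c p) (\<lambda>i. if i = 0 then R c (snd c p) else w) = 0))"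

definition integral_curve ::
  "'a topology \<Rightarrow> ('a, 'e::euclidean_space) chart set \<Rightarrow> ('a, 'e) vfield \<Rightarrow>
   (real \<Rightarrow> 'a) \<Rightarrow> bool" where
  "integral_curve M A v \<gamma> \<longleftrightarrow>
     continuous_map euclideanreal M \<gamma> \<and>
     (\<forall>c\<in>A. \<forall>t. \<gamma> t \<in> fst c \<longrightarrow>
        ((snd c \<circ> \<gamma>) has_vector_derivative v c (snd c (\<gamma> t))) (at t))"

definition periodic_orbit_in ::
  "'a topology \<Rightarrow> ('a, 'e::euclidean_space) chart set \<Rightarrow> ('a, 'e) vfield \<Rightarrow> 'a set \<Rightarrow>
   (real \<Rightarrow> 'a) \<Rightarrow> bool" where
  "periodic_orbit_in M A v S \<gamma> \<longleftrightarrow>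
     integral_curve M A v \<gamma> \<and> range \<gamma> \<subseteq> S \<and> (\<exists>T>0. \<forall>t. \<gamma> (t + T) = \<gamma> t)"

end

theory Submission
  imports Defs
begin

text \<open>The manifold is the unit sphere in \<open>'e \<times> real\<close>, a space of even dimension \<open>2n + 2\<close>, and
  \<open>z\<close> is the last coordinate \<open>s\<close>, so that \<open>Z\<close> is the equator.  Choose an orthogonal complex
  structure \<open>J\<close> on the ambient space, let \<open>\<partial>\<^sub>s\<close> be the last basis vector, \<open>y\<close> the linear
  coordinate dual to \<open>J \<partial>\<^sub>s\<close>, and let \<open>\<lambda>\<close> be the standard Liouville form
  \<open>1/2 \<Sum> (x\<^sub>i dy\<^sub>i - y\<^sub>i dx\<^sub>i)\<close> on the complement of the \<open>(s, y)\<close>-plane.  The contact form is the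
  restriction to the sphere of
  \<open>\<alpha> = s^(m+1)/(m+1) dy - y (1 - s^(2m)) ds/s^m + \<lambda>\<close>.
  Its derivative is \<open>ds/s^m \<and> dy + d\<lambda>\<close>, the standard \<open>b\<^sup>m\<close>-symplectic form, which has constant
  coefficients in the frame in which \<open>\<partial>\<^sub>s\<close> is replaced by \<open>s^m \<partial>\<^sub>s\<close>.

  The Liouville vector field of \<open>\<alpha>\<close> is transverse to the sphere in the \<open>b\<^sup>m\<close>-sense: its pairing
  with \<open>d(|p|\<^sup>2)/2\<close> is positive, also on the equator (lemma \<open>liouville_transverse\<close>).  As for
  ordinary symplectic forms, this makes \<open>\<alpha>\<close> a contact form.  The exponent \<open>m + 1\<close> in the first
  coefficient is what makes this work for even and for odd \<open>m\<close>: the \<open>s\<close>-component of the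
  Liouville field, multiplied by \<open>s\<close>, is then an even power of \<open>s\<close> with a positive coefficient.

  The Reeb field is a positive multiple of the Hamiltonian vector field of \<open>|p|\<^sup>2/2\<close>.  Along its
  orbits \<open>y\<close> changes at the rate \<open>s^(m+1)/D\<close> with \<open>D > 0\<close>, which does not vanish off the equator.
  On a periodic orbit \<open>y\<close> would have a critical point, so the complement of \<open>Z\<close> contains none
  (lemma \<open>no_periodic_orbits\<close>).

  The form is handled through ambient vector-valued functions, pulled back by two stereographic
  charts.  Non-degeneracy of \<open>\<alpha> \<and> (d\<alpha>)^n\<close> at a point is reduced to linear algebra: on a frame
  that consists of the Reeb vector and a symplectic family in the kernel of \<open>\<alpha>\<close>, all terms of
  the permutation sum that defines the wedge product are non-negative and one is positive
  (lemmas \<open>wedge_power_symplectic_pos\<close> and \<open>wedge_contact_pos\<close>).\<close>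

section \<open>Wedge products and permutations\<close>

lemma wedge_permute:
  assumes "\<rho> permutes {..<k + l}"
  shows "wedge k l \<omega> \<eta> (\<lambda>i. v (\<rho> i)) = of_int (sign \<rho>) * wedge k l \<omega> \<eta> v"
proof -
  let ?P = "{\<sigma>. \<sigma> permutes {..<k + l}}"
  define F where "F \<sigma> = of_int (sign \<sigma>) * \<omega> (\<lambda>i. v (\<sigma> i)) * \<eta> (\<lambda>i. v (\<sigma> (k + i)))" for \<sigma>
  have sgn: "sign (\<rho> \<circ> \<sigma>) = sign \<rho> * sign \<sigma>" if "\<sigma> \<in> ?P" for \<sigma>
    using that assms by (intro sign_compose) (auto simp: permutation_permutes)
  have "sum F ?P = (\<Sum>\<sigma>\<in>?P. F (\<rho> \<circ> \<sigma>))"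
    by (rule setum_permutations_compose_left[OF assms])
  also have "of_int (sign \<rho>) * \<dots> =
      (\<Sum>\<sigma>\<in>?P. of_int (sign \<sigma>) * \<omega> (\<lambda>i. v (\<rho> (\<sigma> i))) * \<eta> (\<lambda>i. v (\<rho> (\<sigma> (k + i)))))"
    unfolding sum_distrib_left
  proof (rule sum.cong)
    fix \<sigma> assume "\<sigma> \<in> ?P"
    then have "of_int (sign \<rho>) * of_int (sign (\<rho> \<circ> \<sigma>)) = (of_int (sign \<sigma>) :: real)"
      by (simp add: sgn flip: of_int_mult)
    then show "of_int (sign \<rho>) * F (\<rho> \<circ> \<sigma>) =
        of_int (sign \<sigma>) * \<omega> (\<lambda>i. v (\<rho> (\<sigma> i))) * \<eta> (\<lambda>i. v (\<rho> (\<sigma> (k + i))))"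
      by (simp add: F_def flip: mult.assoc)
  qed simp
  finally show ?thesis
    by (simp add: wedge_def F_def)
qed

lemma wedge_power_permute:
  assumes "\<rho> permutes {..<k * n}"
  shows "wedge_power k \<omega> n (\<lambda>i. v (\<rho> i)) = of_int (sign \<rho>) * wedge_power k \<omega> n v"
proof (cases n)
  case 0
  then show ?thesis using assms by simp
next
  case (Suc n)
  then show ?thesis using assms wedge_permute[of \<rho> k "k * n" \<omega> "wedge_power k \<omega> n" v] by simp
qed

text \<open>Pulling back along a map of vectors commutes with wedge products.  This moves all
  computations from coordinates to the ambient space.\<close>
lemma wedge_compose:
  "wedge k l (\<lambda>u. \<omega> (\<lambda>i. B (u i))) (\<lambda>u. \<eta> (\<lambda>i. B (u i))) v = wedge k l \<omega> \<eta> (\<lambda>i. B (v i))"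
  by (simp add: wedge_def)

lemma wedge_power_compose:
  "wedge_power k (\<lambda>u. \<omega> (\<lambda>i. B (u i))) n v = wedge_power k \<omega> n (\<lambda>i. B (v i))"
proof (induction n arbitrary: v)
  case (Suc n)
  then have eq: "wedge_power k (\<lambda>u. \<omega> (\<lambda>i. B (u i))) n = (\<lambda>v. wedge_power k \<omega> n (\<lambda>i. B (v i)))"
    by auto
  show ?case by (simp add: eq wedge_compose)
qed simp

text \<open>If \<open>\<sigma>\<close> fixes the first \<open>k\<close> indices, it acts on the tail \<open>v\<^sub>k, v\<^sub>k\<^sub>+\<^sub>1, \<dots>\<close> as a permutation of
  the same sign, which an antisymmetric map turns into that sign.\<close>
lemma permute_tail:
  fixes \<sigma> :: "nat \<Rightarrow> nat"
  assumes anti: "\<And>\<rho> v. \<rho> permutes {..<l} \<Longrightarrow> \<eta> (\<lambda>i. v (\<rho> i)) = of_int (sign \<rho>) * (\<eta> v :: real)"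
    and \<sigma>: "\<sigma> permutes {..<k + l}" and fixd: "\<And>i. i < k \<Longrightarrow> \<sigma> i = i"
  shows "\<eta> (\<lambda>i. v (\<sigma> (k + i))) = of_int (sign \<sigma>) * \<eta> (\<lambda>i. v (k + i))"
proof -
  let ?A = "{k..<k + l}"
  have \<sigma>A: "\<sigma> permutes ?A"
    by (rule permutes_superset[OF \<sigma>]) (use fixd in \<open>auto simp: not_le\<close>)
  define \<tau> where "\<tau> = map_permutation ?A (\<lambda>i. i - k) \<sigma>"
  have inj: "inj_on (\<lambda>i. i - k) ?A" by (auto simp: inj_on_def)
  have bij: "bij_betw (\<lambda>i. i - k) ?A {..<l}"
    by (rule bij_betw_byWitness[where f' = "\<lambda>i. i + k"]) auto
  have \<tau>: "\<tau> permutes {..<l}"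
    unfolding \<tau>_def by (rule map_permutation_permutes[OF bij \<sigma>A])
  have sgn: "sign \<tau> = sign \<sigma>"
    unfolding \<tau>_def by (rule sign_map_permutation[OF inj \<sigma>A]) simp
  have eq: "\<sigma> (k + i) = k + \<tau> i" for i
  proof (cases "i < l")
    case True
    have "\<tau> ((k + i) - k) = \<sigma> (k + i) - k"
      unfolding \<tau>_def using True by (intro map_permutation_apply[OF inj]) auto
    moreover have "\<sigma> (k + i) \<in> ?A" using True permutes_in_image[OF \<sigma>A, of "k + i"] by auto
    ultimately show ?thesis by auto
  next
    case False
    then show ?thesis using permutes_not_in[OF \<sigma>A, of "k + i"] permutes_not_in[OF \<tau>, of i] by auto
  qed
  show ?thesis
    using anti[OF \<tau>, of "\<lambda>i. v (k + i)"] by (simp add: eq sgn)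
qed

text \<open>The values of the wedge products that matter below never involve cancellation, so
  bounding the permutation sum from below by the term of the identity suffices.\<close>
lemma wedge_pos:
  assumes nn: "\<And>\<sigma>. \<sigma> permutes {..<k + l} \<Longrightarrow>
      of_int (sign \<sigma>) * \<omega> (\<lambda>i. v (\<sigma> i)) * \<eta> (\<lambda>i. v (\<sigma> (k + i))) \<ge> 0"
    and pos: "\<omega> v * \<eta> (\<lambda>i. v (k + i)) > 0"
  shows "wedge k l \<omega> \<eta> v > 0"
proof -
  let ?P = "{\<sigma>. \<sigma> permutes {..<k + l}}"
  have "0 < (\<Sum>\<sigma>\<in>?P. of_int (sign \<sigma>) * \<omega> (\<lambda>i. v (\<sigma> i)) * \<eta> (\<lambda>i. v (\<sigma> (k + i))))"
  proof (rule sum_pos2)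
    show "finite ?P" by (rule finite_permutations) simp
    show "id \<in> ?P" by (simp add: permutes_id)
  qed (use nn pos in auto)
  then show ?thesis by (simp add: wedge_def)
qed

section \<open>Symplectic linear algebra\<close>

text \<open>The vectors at positions \<open>2i\<close> and \<open>2i + 1\<close> form the \<open>i\<close>-th hyperbolic pair.\<close>
definition symplectic_family :: "('v \<Rightarrow> 'v \<Rightarrow> real) \<Rightarrow> nat \<Rightarrow> (nat \<Rightarrow> 'v) \<Rightarrow> bool" where
  "symplectic_family B k v \<longleftrightarrow> (\<forall>i<2 * k. \<forall>j<2 * k.
     B (v i) (v j) = (if even i \<and> j = Suc i then 1 else if odd i \<and> i = Suc j then -1 else 0))"

lemma symplectic_family_tail:
  assumes "symplectic_family B (Suc k) v"
  shows "symplectic_family B k (\<lambda>i. v (2 + i))"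
  unfolding symplectic_family_def
proof (intro allI impI)
  fix i j assume "i < 2 * k" "j < 2 * k"
  then have lt: "2 + i < 2 * Suc k" "2 + j < 2 * Suc k" by auto
  show "B (v (2 + i)) (v (2 + j)) =
      (if even i \<and> j = Suc i then 1 else if odd i \<and> i = Suc j then - 1 else 0)"
    using assms[unfolded symplectic_family_def, rule_format, OF lt] by auto
qed

text \<open>The exchange of the \<open>0\<close>-th and the \<open>i\<close>-th pair.  It is a product of two commuting
  transpositions (trivial ones if \<open>i = 0\<close>), hence always even.\<close>
definition pair_swap :: "nat \<Rightarrow> nat \<Rightarrow> nat" where
  "pair_swap i = Transposition.transpose 0 (2 * i) \<circ> Transposition.transpose 1 (2 * i + 1)"

lemma pair_swap_apply:
  "pair_swap i j = (if j = 0 then 2 * i else if j = 1 then 2 * i + 1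
     else if j = 2 * i then 0 else if j = 2 * i + 1 then 1 else j)"
  by (auto simp: pair_swap_def Transposition.transpose_def)

lemma pair_swap_involution: "pair_swap i (pair_swap i j) = j"
  by (auto simp: pair_swap_apply)

lemma pair_swap_permutes: "i < k \<Longrightarrow> pair_swap i permutes {..<2 * k}"
  unfolding pair_swap_def by (intro permutes_compose permutes_swap_id) auto

lemma sign_pair_swap: "sign (pair_swap i) = 1"
  unfolding pair_swap_def by (subst sign_compose) (auto simp: permutation_swap_id sign_swap_id)

lemma symplectic_family_pair_swap:
  assumes v: "symplectic_family B k v" and i: "i < k"
  shows "symplectic_family B k (\<lambda>j. v (pair_swap i j))"
  unfolding symplectic_family_def
proof (intro allI impI)
  fix a b assume ab: "a < 2 * k" "b < 2 * k"
  have lt: "pair_swap i a < 2 * k" "pair_swap i b < 2 * k"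
    using ab i permutes_in_image[OF pair_swap_permutes[OF i]] by auto
  have "(even (pair_swap i a) \<longleftrightarrow> even a)" by (auto simp: pair_swap_apply)
  moreover have "pair_swap i b = Suc (pair_swap i a) \<longleftrightarrow> b = Suc a" if "even a"
    using that by (auto simp: pair_swap_apply) presburger+
  moreover have "pair_swap i a = Suc (pair_swap i b) \<longleftrightarrow> a = Suc b" if "odd a"
    using that by (auto simp: pair_swap_apply) presburger+
  ultimately show "B (v (pair_swap i a)) (v (pair_swap i b)) =
      (if even a \<and> b = Suc a then 1 else if odd a \<and> a = Suc b then - 1 else 0)"
    using v lt unfolding symplectic_family_def by auto
qed

text \<open>In the permutation sum for \<open>\<omega> \<and> \<omega>^k\<close> only those \<open>\<sigma>\<close> contribute that move a hyperbolic pair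
  to the front, possibly reversed.  Composing \<open>\<sigma>\<close> with the exchange of this pair with the
  first one leaves a permutation of the remaining \<open>2k\<close> vectors, whose sign cancels against
  the sign of \<open>\<sigma>\<close>; what remains is \<open>\<omega>^k\<close> on a symplectic family, positive by induction.\<close>
lemma wedge_power_symplectic_pos:
  fixes B :: "'v \<Rightarrow> 'v \<Rightarrow> real"
  assumes "symplectic_family B k v"
  shows "wedge_power 2 (\<lambda>u. B (u 0) (u 1)) k v > 0"
  using assms
proof (induction k arbitrary: v)
  case 0
  then show ?case by simp
next
  case (Suc k)
  let ?\<omega> = "\<lambda>u. B (u 0) (u 1)"
  let ?\<eta> = "wedge_power 2 ?\<omega> k"
  have anti: "?\<eta> (\<lambda>i. w (\<rho> i)) = of_int (sign \<rho>) * ?\<eta> w" if "\<rho> permutes {..<2 * k}" for \<rho> w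
    by (rule wedge_power_permute[OF that])
  have B: "B (v i) (v j) = (if even i \<and> j = Suc i then 1 else if odd i \<and> i = Suc j then -1 else 0)"
    if "i < 2 * Suc k" "j < 2 * Suc k" for i j
    using Suc.prems that unfolding symplectic_family_def by blast
  have "wedge 2 (2 * k) ?\<omega> ?\<eta> v > 0"
  proof (rule wedge_pos)
    show "?\<omega> v * ?\<eta> (\<lambda>i. v (2 + i)) > 0"
      using Suc.IH[OF symplectic_family_tail[OF Suc.prems]] B[of 0 1] by simp
  next
    have main: "?\<eta> (\<lambda>i. v (\<sigma> (2 + i))) * of_int (sign \<sigma>) > 0"
      if \<sigma>: "\<sigma> permutes {..<2 + 2 * k}" and i: "\<sigma> 0 = 2 * i" "\<sigma> 1 = 2 * i + 1" for \<sigma> i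
    proof -
      have "\<sigma> 1 < 2 + 2 * k" using permutes_in_image[OF \<sigma>, of 1] by auto
      then have ik: "i < Suc k" using i by auto
      define \<tau> where "\<tau> = pair_swap i \<circ> \<sigma>"
      have sw: "pair_swap i permutes {..<2 + 2 * k}" using pair_swap_permutes[OF ik] by simp
      have \<tau>: "\<tau> permutes {..<2 + 2 * k}"
        unfolding \<tau>_def by (rule permutes_compose[OF \<sigma> sw])
      have sgn: "sign \<tau> = sign \<sigma>"
        unfolding \<tau>_def using \<sigma> sw
        by (subst sign_compose) (auto simp: permutation_permutes sign_pair_swap)
      have fixd: "\<tau> j = j" if "j < 2" for j
        using that i by (cases "j = 0") (auto simp: \<tau>_def pair_swap_apply less_2_cases_iff)
      have "?\<eta> (\<lambda>j. v (\<sigma> (2 + j))) = ?\<eta> (\<lambda>j. (\<lambda>a. v (pair_swap i a)) (\<tau> (2 + j)))"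
        by (simp add: \<tau>_def pair_swap_involution)
      also have "\<dots> = of_int (sign \<tau>) * ?\<eta> (\<lambda>j. v (pair_swap i (2 + j)))"
        by (rule permute_tail[OF anti \<tau> fixd])
      finally have eq: "?\<eta> (\<lambda>j. v (\<sigma> (2 + j))) =
          of_int (sign \<sigma>) * ?\<eta> (\<lambda>j. v (pair_swap i (2 + j)))" by (simp add: sgn)
      have "?\<eta> (\<lambda>j. v (pair_swap i (2 + j))) > 0"
        by (rule Suc.IH[OF symplectic_family_tail[OF symplectic_family_pair_swap[OF Suc.prems ik]]])
      then show ?thesis by (subst eq) (simp add: sign_def)
    qed
    fix \<sigma> assume \<sigma>: "\<sigma> permutes {..<2 + 2 * k}"
    have lt: "\<sigma> 0 < 2 * Suc k" "\<sigma> 1 < 2 * Suc k"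
      using permutes_in_image[OF \<sigma>, of 0] permutes_in_image[OF \<sigma>, of 1] by auto
    consider "even (\<sigma> 0)" "\<sigma> 1 = Suc (\<sigma> 0)" | "odd (\<sigma> 0)" "\<sigma> 0 = Suc (\<sigma> 1)"
      | "B (v (\<sigma> 0)) (v (\<sigma> 1)) = 0"
      using B[OF lt] by metis
    then show "of_int (sign \<sigma>) * ?\<omega> (\<lambda>i. v (\<sigma> i)) * ?\<eta> (\<lambda>i. v (\<sigma> (2 + i))) \<ge> 0"
    proof cases
      case 1
      then obtain i where "\<sigma> 0 = 2 * i" by blast
      then have "?\<eta> (\<lambda>i. v (\<sigma> (2 + i))) * of_int (sign \<sigma>) > 0" using 1 main[OF \<sigma>] by simp
      then show ?thesis using 1 B[OF lt] by (simp add: mult.commute)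
    next
      case 2
      \<comment> \<open>The pair is reversed; a transposition changes both the sign of \<open>\<sigma>\<close> and that of \<open>B\<close>.\<close>
      then obtain i where i: "\<sigma> 1 = 2 * i" by (metis even_Suc evenE)
      let ?\<sigma>' = "\<sigma> \<circ> Transposition.transpose 0 1"
      have tr: "Transposition.transpose 0 1 permutes {..<2 + 2 * k}" by (rule permutes_swap_id) auto
      have \<sigma>': "?\<sigma>' permutes {..<2 + 2 * k}"
        by (rule permutes_compose[OF tr \<sigma>])
      have sgn: "sign ?\<sigma>' = - sign \<sigma>"
        using \<sigma> tr by (subst sign_compose) (auto simp: permutation_permutes sign_swap_id)
      have "?\<eta> (\<lambda>i. v (?\<sigma>' (2 + i))) * of_int (sign ?\<sigma>') > 0"
        by (rule main[OF \<sigma>', of i]) (use 2 i in simp_all)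
      then have "?\<eta> (\<lambda>i. v (\<sigma> (2 + i))) * of_int (sign \<sigma>) < 0"
        unfolding sgn by (simp add: Transposition.transpose_def)
      then show ?thesis using 2 B[OF lt] by (simp add: mult.commute)
    qed simp
  qed
  then show ?case by simp
qed

text \<open>Since \<open>a\<close> annihilates all vectors but the first, only the permutations that fix \<open>0\<close>
  contribute to \<open>a \<and> \<omega>^n\<close>.\<close>
lemma wedge_contact_pos:
  fixes B :: "'v \<Rightarrow> 'v \<Rightarrow> real"
  assumes 0: "a (v 0) = 1" and ker: "\<And>i. i < 2 * n \<Longrightarrow> a (v (Suc i)) = 0"
    and sym: "symplectic_family B n (\<lambda>i. v (Suc i))"
  shows "wedge 1 (2 * n) (\<lambda>u. a (u 0)) (wedge_power 2 (\<lambda>u. B (u 0) (u 1)) n) v > 0"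
proof (rule wedge_pos)
  let ?\<eta> = "wedge_power 2 (\<lambda>u. B (u 0) (u 1)) n"
  have pos: "?\<eta> (\<lambda>i. v (1 + i)) > 0"
    using wedge_power_symplectic_pos[OF sym] by simp
  then show "a (v 0) * ?\<eta> (\<lambda>i. v (1 + i)) > 0" using 0 by simp
  fix \<sigma> assume \<sigma>: "\<sigma> permutes {..<1 + 2 * n}"
  show "of_int (sign \<sigma>) * a (v (\<sigma> 0)) * ?\<eta> (\<lambda>i. v (\<sigma> (1 + i))) \<ge> 0"
  proof (cases "\<sigma> 0 = 0")
    case True
    have "?\<eta> (\<lambda>i. v (\<sigma> (1 + i))) = of_int (sign \<sigma>) * ?\<eta> (\<lambda>i. v (1 + i))"
      by (rule permute_tail[OF wedge_power_permute \<sigma>]) (use True in auto)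
    then show ?thesis using pos True 0 by (simp add: sign_def)
  next
    case False
    then obtain i where i: "\<sigma> 0 = Suc i" using not0_implies_Suc by blast
    have "\<sigma> 0 < 1 + 2 * n" using permutes_in_image[OF \<sigma>, of 0] by auto
    then show ?thesis using ker[of i] i by simp
  qed
qed

text \<open>Symplectic Gram-Schmidt: split off a hyperbolic pair and continue in its orthogonal
  complement within \<open>U\<close>, whose dimension is smaller by at most 2.  The bound
  admits \<open>dim U = 2k - 1\<close>, which does no harm: nondegeneracy forces an even dimension.\<close>
lemma symplectic_family_exists:
  fixes B :: "'v::euclidean_space \<Rightarrow> 'v \<Rightarrow> real"
  assumes B: "bilinear B" and skew: "\<And>x y. B x y = - B y x"
    and U: "subspace U" "2 * k \<le> Suc (dim U)"
    and nondeg: "\<And>u. u \<in> U \<Longrightarrow> u \<noteq> 0 \<Longrightarrow> \<exists>w\<in>U. B u w \<noteq> 0"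
  shows "\<exists>v. (\<forall>i. v i \<in> U) \<and> symplectic_family B k v"
  using U nondeg
proof (induction k arbitrary: U)
  case 0
  then show ?case by (intro exI[of _ "\<lambda>_. 0"]) (auto simp: symplectic_family_def subspace_0)
next
  case (Suc k)
  note sub = Suc.prems(1)
  note lin = bilinear_ladd[OF B] bilinear_radd[OF B] bilinear_lmul[OF B] bilinear_rmul[OF B]
    bilinear_lsub[OF B] bilinear_rsub[OF B] bilinear_lzero[OF B] bilinear_rzero[OF B]
  have diag: "B x x = 0" for x using skew[of x x] by simp
  have "1 \<le> dim U" using Suc.prems(2) by simp
  then have "\<not> U \<subseteq> {0}" using dim_subset[of U "{0}"] by (metis dim_singleton not_one_le_zero order_trans)
  then obtain e where e: "e \<in> U" "e \<noteq> 0" by blast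
  then obtain f0 where f0: "f0 \<in> U" "B e f0 \<noteq> 0" using Suc.prems(3) by blast
  define f where "f = (1 / B e f0) *\<^sub>R f0"
  have f: "f \<in> U" "B e f = 1"
    using f0 by (auto simp: f_def lin subspace_scale[OF sub])
  have fe: "B f e = -1" using skew[of f e] f by simp
  define U' where "U' = {u \<in> U. B e u = 0 \<and> B f u = 0}"
  have sub': "subspace U'"
    using sub unfolding U'_def subspace_def by (auto simp: lin)
  \<comment> \<open>the projection onto \<open>U'\<close> along the span of \<open>e\<close> and \<open>f\<close>\<close>
  define pr where "pr u = u - B e u *\<^sub>R f + B f u *\<^sub>R e" for u
  have prU: "pr u \<in> U'" if "u \<in> U" for u
    using that e f fe
    by (auto simp: U'_def pr_def lin diag intro!: subspace_add[OF sub] subspace_diff[OF sub] subspace_scale[OF sub])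
  have "U \<subseteq> span ({e, f} \<union> U')"
  proof
    fix u assume "u \<in> U"
    then have "pr u + B e u *\<^sub>R f - B f u *\<^sub>R e \<in> span ({e, f} \<union> U')"
      by (intro span_add span_diff span_scale) (auto intro!: span_base prU)
    then show "u \<in> span ({e, f} \<union> U')" by (simp add: pr_def)
  qed
  then have "dim U \<le> dim ({e, f} \<union> U')" by (metis dim_span dim_subset)
  also have "\<dots> \<le> Suc (Suc (dim U'))" by (simp add: dim_insert)
  finally have dim': "2 * k \<le> Suc (dim U')" using Suc.prems(2) by auto
  have nondeg': "\<exists>w\<in>U'. B u w \<noteq> 0" if u: "u \<in> U'" "u \<noteq> 0" for u
  proof -
    obtain w where w: "w \<in> U" "B u w \<noteq> 0" using Suc.prems(3) u unfolding U'_def by blast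
    have "B u e = 0" "B u f = 0" using u skew[of u e] skew[of u f] by (auto simp: U'_def)
    then have "B u (pr w) = B u w" by (simp add: pr_def lin)
    then show ?thesis using prU[OF w(1)] w(2) by (intro bexI[of _ "pr w"]) simp_all
  qed
  obtain v where v: "\<And>i. v i \<in> U'" "symplectic_family B k v"
    using Suc.IH[OF sub' dim' nondeg'] by blast
  define v' where "v' i = (if i = 0 then e else if i = 1 then f else v (i - 2))" for i
  have ev: "B e (v i) = 0" "B f (v i) = 0" "B (v i) e = 0" "B (v i) f = 0" for i
    using v(1)[of i] skew[of "v i" e] skew[of "v i" f] by (auto simp: U'_def)
  have "symplectic_family B (Suc k) v'"
    unfolding symplectic_family_def
  proof (intro allI impI)
    fix i j assume ij: "i < 2 * Suc k" "j < 2 * Suc k"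
    consider "i < 2" | "j < 2" "i \<ge> 2" | "i \<ge> 2" "j \<ge> 2" by linarith
    then show "B (v' i) (v' j) = (if even i \<and> j = Suc i then 1 else if odd i \<and> i = Suc j then - 1 else 0)"
    proof cases
      case 1
      then show ?thesis using f fe ev diag by (auto simp: v'_def less_2_cases_iff)
    next
      case 2
      then show ?thesis using f fe ev diag by (auto simp: v'_def less_2_cases_iff)
    next
      case 3
      then obtain i' j' where "i = i' + 2" "j = j' + 2" by (metis le_add_diff_inverse2)
      then show ?thesis using ij v(2) by (auto simp: v'_def symplectic_family_def)
    qed
  qed
  moreover have "v' i \<in> U" for i using e f v(1) by (auto simp: v'_def U'_def)
  ultimately show ?case by blast
qed

text \<open>Split the basis into two halves and let \<open>J\<close> exchange them along a bijection, with a sign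
  on one half.\<close>
lemma complex_structure_exists:
  assumes "DIM('v::euclidean_space) = 2 * k"
  shows "\<exists>J :: 'v \<Rightarrow> 'v. linear J \<and> (\<forall>v. J (J v) = - v) \<and> (\<forall>v w. J v \<bullet> w = - (v \<bullet> J w))"
proof -
  obtain P :: "'v set" where P: "P \<subseteq> Basis" "card P = k"
    using obtain_subset_with_card_n[of k "Basis :: 'v set"] assms by auto
  define Q where "Q = Basis - P"
  have fin: "finite P" "finite Q" using finite_subset[OF P(1)] by (auto simp: Q_def)
  have "card Q = k" using P assms by (simp add: Q_def card_Diff_subset fin)
  then obtain h where h: "bij_betw h P Q" using P fin finite_same_card_bij by metis
  have hQ: "h b \<in> Q" if "b \<in> P" for b using h that by (auto simp: bij_betw_def)
  define J where "J v = (\<Sum>b\<in>P. (v \<bullet> b) *\<^sub>R h b - (v \<bullet> h b) *\<^sub>R b)" for v :: 'v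
  have lin: "linear J"
    by (rule linearI) (auto simp: J_def algebra_simps inner_add_left sum.distrib sum_subtractf scaleR_sum_right)
  have skew: "J v \<bullet> w = - (v \<bullet> J w)" for v w
    by (simp add: J_def inner_sum_left inner_sum_right inner_diff_left inner_diff_right sum_negf[symmetric] mult.commute inner_commute)
  have inner: "b \<bullet> c = (if b = c then 1 else 0)" if "b \<in> Basis" "c \<in> Basis" for b c :: 'v
    using that by (rule inner_Basis)
  have JP: "J b = h b" if b: "b \<in> P" for b
  proof -
    have "J b = (\<Sum>c\<in>P. if c = b then h b else 0)"
      unfolding J_def
    proof (rule sum.cong)
      fix c assume c: "c \<in> P"
      have "b \<bullet> c = (if c = b then 1 else 0)" "b \<bullet> h c = 0"
        using inner[of b c] inner[of b "h c"] subsetD[OF P(1) b] subsetD[OF P(1) c] b hQ[OF c] by (auto simp: Q_def)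
      then show "(b \<bullet> c) *\<^sub>R h c - (b \<bullet> h c) *\<^sub>R c = (if c = b then h b else 0)" by simp
    qed simp
    then show ?thesis using b fin by simp
  qed
  have JQ: "J (h b) = - b" if b: "b \<in> P" for b
  proof -
    have "J (h b) = (\<Sum>c\<in>P. if c = b then - b else 0)"
      unfolding J_def
    proof (rule sum.cong)
      fix c assume c: "c \<in> P"
      have "h b \<bullet> c = 0" "h b \<bullet> h c = (if c = b then 1 else 0)"
        using inner[of "h b" c] inner[of "h b" "h c"] subsetD[OF P(1) c] b c hQ[OF c] hQ[OF b] h
        by (auto simp: Q_def bij_betw_def inj_on_def)
      then show "(h b \<bullet> c) *\<^sub>R h c - (h b \<bullet> h c) *\<^sub>R c = (if c = b then - b else 0)" by simp
    qed simp
    then show ?thesis using b fin by simp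
  qed
  have "J \<circ> J = uminus"
  proof (rule linear_eq_stdbasis)
    show "linear (J \<circ> J)" by (rule linear_compose[OF lin lin])
    show "linear (uminus :: 'v \<Rightarrow> 'v)" by (rule linear_uminus)
    fix b :: 'v assume "b \<in> Basis"
    then consider "b \<in> P" | "b \<in> Q" by (auto simp: Q_def)
    then show "(J \<circ> J) b = - b"
    proof cases
      case 1
      then show ?thesis by (simp add: JP JQ)
    next
      case 2
      then obtain c where "c \<in> P" "b = h c" using h by (auto simp: bij_betw_def)
      then show ?thesis by (simp add: JP JQ linear_neg[OF lin])
    qed
  qed
  then have "J (J v) = - v" for v by (metis comp_apply)
  then show ?thesis using lin skew by blast
qed

section \<open>Smooth functions on open sets\<close>

text \<open>The higher derivatives in \<open>Ck_on\<close> are taken at interior points, so that a function matters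
  only up to its values on the open set \<open>S\<close>.  All smooth maps used below are rational in a
  Euclidean variable, so closure under linear maps, bilinear products and inverses covers
  everything.\<close>
lemma Ck_on_cong:
  assumes "open S" "\<And>x. x \<in> S \<Longrightarrow> f x = g x"
  shows "Ck_on k S f \<longleftrightarrow> Ck_on k S g"
  using assms(2)
proof (induction k arbitrary: f g)
  case 0
  then show ?case by (simp cong: continuous_on_cong)
next
  case (Suc k)
  have dif: "f differentiable (at x) \<longleftrightarrow> g differentiable (at x)" if "x \<in> S" for x
  proof
    show "g differentiable (at x)" if "f differentiable (at x)"
      using that \<open>x \<in> S\<close> assms(1) Suc.prems
      by (meson differentiable_def has_derivative_transform_within_open)
    show "f differentiable (at x)" if "g differentiable (at x)"
      using that \<open>x \<in> S\<close> assms(1) Suc.prems[symmetric]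
      by (meson differentiable_def has_derivative_transform_within_open)
  qed
  have eq: "frechet_derivative f (at x) v = frechet_derivative g (at x) v"
    if "x \<in> S" "f differentiable (at x)" for x v
    using frechet_derivative_transform_within_open[OF that(2) assms(1) that(1)] Suc.prems by metis
  have "Ck_on k S (\<lambda>x. frechet_derivative f (at x) v) \<longleftrightarrow>
        Ck_on k S (\<lambda>x. frechet_derivative g (at x) v)"
    if "\<forall>x\<in>S. f differentiable (at x)" for v
    using that eq by (intro Suc.IH) auto
  then show ?case using dif by auto
qed

lemma Ck_on_SucI:
  assumes "open S" "\<And>x. x \<in> S \<Longrightarrow> (f has_derivative f' x) (at x)"
    and "\<And>v. Ck_on k S (\<lambda>x. f' x v)"
  shows "Ck_on (Suc k) S f"
proof -
  have eq: "frechet_derivative f (at x) v = f' x v" if "x \<in> S" for x v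
    using frechet_derivative_at[OF assms(2)[OF that]] by simp
  have "Ck_on k S (\<lambda>x. frechet_derivative f (at x) v)" for v
    using assms(3)[of v] Ck_on_cong[OF assms(1) eq] by simp
  then show ?thesis using assms(2) by (auto simp: differentiable_def)
qed

lemma Ck_on_Suc_imp: "Ck_on (Suc k) S f \<Longrightarrow> Ck_on k S f"
proof (induction k arbitrary: f)
  case 0
  then show ?case
    by (auto intro!: continuous_at_imp_continuous_on differentiable_imp_continuous_within)
qed auto

lemma Ck_on_Suc_deriv:
  assumes "Ck_on (Suc k) S f" "x \<in> S"
  shows "(f has_derivative frechet_derivative f (at x)) (at x)"
  using assms frechet_derivative_works by auto

lemma Ck_on_const: "open S \<Longrightarrow> Ck_on k S (\<lambda>x. c)"
proof (induction k arbitrary: c)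
  case (Suc k)
  then show ?case by (intro Ck_on_SucI[where f' = "\<lambda>x v. 0"]) auto
qed auto

lemma Ck_on_add:
  assumes "open S"
  shows "Ck_on k S f \<Longrightarrow> Ck_on k S g \<Longrightarrow> Ck_on k S (\<lambda>x. f x + g x)"
proof (induction k arbitrary: f g)
  case (Suc k)
  show ?case
    using Suc
    by (intro Ck_on_SucI[OF assms has_derivative_add, OF Ck_on_Suc_deriv Ck_on_Suc_deriv]) auto
qed (auto intro: continuous_on_add)

lemma Ck_on_bounded_linear:
  assumes S: "open S" and L: "bounded_linear L"
  shows "Ck_on k S f \<Longrightarrow> Ck_on k S (\<lambda>x. L (f x))"
proof (induction k arbitrary: f)
  case 0
  then show ?case using bounded_linear.continuous_on[OF L] by auto
next
  case (Suc k)
  show ?case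
    using Suc
    by (intro Ck_on_SucI[OF S bounded_linear.has_derivative[OF L], OF Ck_on_Suc_deriv]) auto
qed

lemma Ck_on_bounded_bilinear:
  assumes S: "open S" and B: "bounded_bilinear B"
  shows "Ck_on k S f \<Longrightarrow> Ck_on k S g \<Longrightarrow> Ck_on k S (\<lambda>x. B (f x) (g x))"
proof (induction k arbitrary: f g)
  case 0
  then show ?case using bounded_bilinear.continuous_on[OF B] by auto
next
  case (Suc k)
  note lower = Suc.prems[THEN Ck_on_Suc_imp]
  show ?case
  proof (rule Ck_on_SucI[OF S bounded_bilinear.FDERIV[OF B]])
    fix x assume "x \<in> S"
    then show "(f has_derivative frechet_derivative f (at x)) (at x)"
      "(g has_derivative frechet_derivative g (at x)) (at x)"
      using Suc.prems Ck_on_Suc_deriv by blast+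
  next
    fix v
    show "Ck_on k S (\<lambda>x. B (f x) (frechet_derivative g (at x) v) + B (frechet_derivative f (at x) v) (g x))"
      using Suc.prems lower by (intro Ck_on_add[OF S] Suc.IH) auto
  qed
qed

lemma Ck_on_inverse:
  fixes f :: "'e::euclidean_space \<Rightarrow> real"
  assumes S: "open S" and nz: "\<And>x. x \<in> S \<Longrightarrow> f x \<noteq> 0"
  shows "Ck_on k S f \<Longrightarrow> Ck_on k S (\<lambda>x. inverse (f x))"
proof (induction k)
  case 0
  then show ?case using nz by (auto intro: continuous_on_inverse)
next
  case (Suc k)
  note IH = Suc.IH[OF Ck_on_Suc_imp[OF Suc.prems]]
  show ?case
  proof (rule Ck_on_SucI[OF S])
    fix x assume x: "x \<in> S"
    show "((\<lambda>x. inverse (f x)) has_derivative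
       (\<lambda>v. - (inverse (f x) * frechet_derivative f (at x) v * inverse (f x)))) (at x)"
      by (rule Deriv.has_derivative_inverse[OF nz[OF x] Ck_on_Suc_deriv[OF Suc.prems x]])
  next
    fix v
    have "Ck_on k S (\<lambda>x. frechet_derivative f (at x) v)" using Suc.prems by simp
    then show "Ck_on k S (\<lambda>x. - (inverse (f x) * frechet_derivative f (at x) v * inverse (f x)))"
      by (intro Ck_on_bounded_linear[OF S bounded_linear_minus[OF bounded_linear_ident]]
          Ck_on_bounded_bilinear[OF S bounded_bilinear_mult] IH)
  qed
qed

named_theorems smooth_intros

lemma smooth_on_const [smooth_intros]: "open S \<Longrightarrow> smooth_on S (\<lambda>x. c)"
  by (simp add: smooth_on_def Ck_on_const)

lemma smooth_on_ident [smooth_intros]: "open S \<Longrightarrow> smooth_on S (\<lambda>x. x)"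
proof -
  assume S: "open S"
  have "Ck_on k S (\<lambda>x. x)" for k
  proof (cases k)
    case (Suc k)
    show ?thesis
      unfolding Suc by (rule Ck_on_SucI[OF S has_derivative_ident Ck_on_const[OF S]])
  qed auto
  then show ?thesis by (simp add: smooth_on_def)
qed

lemma smooth_on_add [smooth_intros]:
  "open S \<Longrightarrow> smooth_on S f \<Longrightarrow> smooth_on S g \<Longrightarrow> smooth_on S (\<lambda>x. f x + g x)"
  by (simp add: smooth_on_def Ck_on_add)

lemma smooth_on_bounded_linear:
  "bounded_linear L \<Longrightarrow> open S \<Longrightarrow> smooth_on S f \<Longrightarrow> smooth_on S (\<lambda>x. L (f x))"
  by (simp add: smooth_on_def Ck_on_bounded_linear)

lemmas smooth_on_fst [smooth_intros] = smooth_on_bounded_linear[OF bounded_linear_fst]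
lemmas smooth_on_snd [smooth_intros] = smooth_on_bounded_linear[OF bounded_linear_snd]
lemmas smooth_on_minus [smooth_intros] =
  smooth_on_bounded_linear[OF bounded_linear_minus[OF bounded_linear_ident]]

lemma smooth_on_diff [smooth_intros]:
  "open S \<Longrightarrow> smooth_on S f \<Longrightarrow> smooth_on S g \<Longrightarrow> smooth_on S (\<lambda>x. f x - g x)"
  using smooth_on_add[OF _ _ smooth_on_minus, of S f g] by simp

lemma smooth_on_bounded_bilinear:
  "bounded_bilinear B \<Longrightarrow> open S \<Longrightarrow> smooth_on S f \<Longrightarrow> smooth_on S g \<Longrightarrow>
    smooth_on S (\<lambda>x. B (f x) (g x))"
  by (simp add: smooth_on_def Ck_on_bounded_bilinear)

lemmas smooth_on_scaleR [smooth_intros] = smooth_on_bounded_bilinear[OF bounded_bilinear_scaleR]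
lemmas smooth_on_inner [smooth_intros] = smooth_on_bounded_bilinear[OF bounded_bilinear_inner]
lemmas smooth_on_mult [smooth_intros] =
  smooth_on_bounded_bilinear[OF bounded_bilinear_mult[where ?'a = real]]

lemma smooth_on_Pair [smooth_intros]:
  assumes "open S" "smooth_on S f" "smooth_on S g"
  shows "smooth_on S (\<lambda>x. (f x, g x))"
proof -
  have "smooth_on S (\<lambda>x. (f x, 0) + (0, g x))"
    by (intro smooth_on_add assms smooth_on_bounded_linear[of "\<lambda>a. (a, 0)"]
        smooth_on_bounded_linear[of "\<lambda>a. (0, a)"] bounded_linear_Pair
        bounded_linear_ident bounded_linear_zero)
  then show ?thesis by simp
qed

lemma smooth_on_inverse [smooth_intros]:
  fixes f :: "'e::euclidean_space \<Rightarrow> real"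
  shows "open S \<Longrightarrow> smooth_on S f \<Longrightarrow> (\<And>x. x \<in> S \<Longrightarrow> f x \<noteq> 0) \<Longrightarrow> smooth_on S (\<lambda>x. inverse (f x))"
  by (simp add: smooth_on_def Ck_on_inverse)

lemma smooth_on_divide [smooth_intros]:
  fixes f g :: "'e::euclidean_space \<Rightarrow> real"
  shows "open S \<Longrightarrow> smooth_on S f \<Longrightarrow> smooth_on S g \<Longrightarrow> (\<And>x. x \<in> S \<Longrightarrow> g x \<noteq> 0) \<Longrightarrow>
    smooth_on S (\<lambda>x. f x / g x)"
  unfolding divide_inverse by (intro smooth_on_mult smooth_on_inverse)

lemma smooth_on_power [smooth_intros]:
  fixes f :: "'e::euclidean_space \<Rightarrow> real"
  assumes "open S" "smooth_on S f"
  shows "smooth_on S (\<lambda>x. f x ^ k)"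
  by (induction k) (auto intro!: smooth_on_const smooth_on_mult assms)

lemma smooth_on_sum:
  assumes "open S" "\<And>i. i \<in> I \<Longrightarrow> smooth_on S (f i)"
  shows "smooth_on S (\<lambda>x. \<Sum>i\<in>I. f i x)"
  using assms(2)
  by (induction I rule: infinite_finite_induct) (auto intro!: smooth_on_const smooth_on_add assms(1))

lemma smooth_on_wedge:
  assumes S: "open S"
    and \<omega>: "\<And>\<sigma>. smooth_on S (\<lambda>x. \<omega> x (\<lambda>i. V (\<sigma> i) x))"
    and \<eta>: "\<And>\<sigma>. smooth_on S (\<lambda>x. \<eta> x (\<lambda>i. V (\<sigma> i) x))"
  shows "smooth_on S (\<lambda>x. wedge k l (\<omega> x) (\<eta> x) (\<lambda>i. V i x))"
  unfolding wedge_def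
  by (intro smooth_on_divide smooth_on_sum smooth_on_mult smooth_on_const S \<omega>) (auto intro: \<eta>)

lemma smooth_on_wedge_power:
  assumes S: "open S" and \<omega>: "\<And>\<sigma>. smooth_on S (\<lambda>x. \<omega> x (\<lambda>i. V (\<sigma> i) x))"
  shows "smooth_on S (\<lambda>x. wedge_power k (\<omega> x) n (\<lambda>i. V (\<sigma> i) x))"
proof (induction n arbitrary: \<sigma>)
  case (Suc n)
  have "smooth_on S (\<lambda>x. wedge k (k * n) (\<omega> x) (wedge_power k (\<omega> x) n) (\<lambda>i. V (\<sigma> i) x))"
    by (rule smooth_on_wedge[OF S, where V = "\<lambda>i. V (\<sigma> i)"]) (use \<omega> Suc in auto)
  then show ?case by simp
qed (simp add: smooth_on_const S)

section \<open>The sphere in stereographic coordinates\<close>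

text \<open>For \<open>\<epsilon> = \<plusminus>1\<close>, the projection from the pole \<open>(0, \<epsilon>)\<close> and its inverse.  The inverse is
  defined on the whole space \<open>'e\<close>, so each chart has image \<open>UNIV\<close>.  The condition on \<open>\<epsilon>\<close> is
  stated as \<open>\<epsilon> * \<epsilon> = 1\<close>, which treats both charts at once.\<close>
definition stereo :: "real \<Rightarrow> 'e::euclidean_space \<times> real \<Rightarrow> 'e" where
  "stereo \<epsilon> p = (1 / (1 - \<epsilon> * snd p)) *\<^sub>R fst p"

definition stereo_param :: "real \<Rightarrow> 'e::euclidean_space \<Rightarrow> 'e \<times> real" where
  "stereo_param \<epsilon> x = ((2 / (x \<bullet> x + 1)) *\<^sub>R x, \<epsilon> * (1 - 2 / (x \<bullet> x + 1)))"

definition stereo_chart :: "real \<Rightarrow> ('e::euclidean_space \<times> real, 'e) chart" where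
  "stereo_chart \<epsilon> = (sphere 0 1 - {(0, \<epsilon>)}, stereo \<epsilon>)"

definition stereo_atlas :: "('e::euclidean_space \<times> real, 'e) chart set" where
  "stereo_atlas = {stereo_chart 1, stereo_chart (-1)}"

lemma denominator_pos: "x \<bullet> x + 1 > (0::real)"
  by (smt (verit) inner_ge_zero)

lemma in_sphere_iff: "p \<in> sphere 0 1 \<longleftrightarrow> fst p \<bullet> fst p + snd p * snd p = 1"
  for p :: "'e::euclidean_space \<times> real"
  by (simp add: norm_eq_1 inner_prod_def)

lemma stereo_param_in_chart:
  fixes x :: "'e::euclidean_space"
  assumes "\<epsilon> * \<epsilon> = 1"
  shows "stereo_param \<epsilon> x \<in> sphere 0 1 - {(0, \<epsilon>)}"
proof -
  define h where "h = 2 / (x \<bullet> x + 1)"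
  have h: "h * (x \<bullet> x) = 2 - h" "h \<noteq> 0"
    using denominator_pos[of x] by (auto simp: h_def field_simps)
  have sq: "(\<epsilon> * a) * (\<epsilon> * a) = a * a" for a using assms by algebra
  have "h * (h * (x \<bullet> x)) + (1 - h) * (1 - h) = 1"
    unfolding h by algebra
  moreover have "\<epsilon> * (1 - h) \<noteq> \<epsilon>" using assms h by auto
  ultimately show ?thesis
    unfolding Diff_iff in_sphere_iff by (simp add: stereo_param_def sq flip: h_def)
qed

lemma stereo_stereo_param:
  assumes "\<epsilon> * \<epsilon> = 1"
  shows "stereo \<epsilon> (stereo_param \<epsilon> x) = x"
proof -
  define h where "h = 2 / (x \<bullet> x + 1)"
  have "h \<noteq> 0" using denominator_pos[of x] by (auto simp: h_def)
  moreover have "1 - \<epsilon> * (\<epsilon> * (1 - h)) = h" using assms by algebra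
  ultimately show ?thesis by (simp add: stereo_def stereo_param_def flip: h_def)
qed

lemma stereo_denominator:
  fixes p :: "'e::euclidean_space \<times> real"
  assumes "\<epsilon> * \<epsilon> = 1" "p \<in> sphere 0 1 - {(0, \<epsilon>)}"
  shows "1 - \<epsilon> * snd p \<noteq> 0"
proof
  assume "1 - \<epsilon> * snd p = 0"
  then have "\<epsilon> * snd p = 1" by linarith
  then have "\<epsilon> * (\<epsilon> * snd p) = \<epsilon>" by simp
  then have "snd p = \<epsilon>" by (simp add: assms(1) flip: mult.assoc)
  then show False using assms in_sphere_iff[of p] by (auto simp: prod_eq_iff)
qed

lemma stereo_param_stereo:
  assumes "\<epsilon> * \<epsilon> = 1" "p \<in> sphere 0 1 - {(0, \<epsilon>)}"
  shows "stereo_param \<epsilon> (stereo \<epsilon> p) = p"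
proof -
  define h where "h = 1 - \<epsilon> * snd p"
  have h: "h \<noteq> 0" using stereo_denominator[OF assms] by (simp add: h_def)
  have sq: "(\<epsilon> * a) * (\<epsilon> * b) = a * b" for a b using assms(1) by algebra
  have "h * (2 - h) = 1 - (\<epsilon> * snd p) * (\<epsilon> * snd p)" by (simp add: h_def algebra_simps)
  then have q: "fst p \<bullet> fst p = h * (2 - h)" using assms(2) in_sphere_iff[of p] unfolding sq by simp
  have "stereo \<epsilon> p \<bullet> stereo \<epsilon> p + 1 = 2 / h"
    using h by (simp add: stereo_def q flip: h_def) (simp add: field_simps)
  then have "2 / (stereo \<epsilon> p \<bullet> stereo \<epsilon> p + 1) = h" using h by simp
  moreover have "\<epsilon> * (1 - h) = snd p" using assms(1) unfolding h_def by algebra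
  ultimately show ?thesis
    using h by (simp add: stereo_param_def prod_eq_iff) (simp add: stereo_def flip: h_def)
qed

text \<open>The factor \<open>h = 2 / (|x|\<^sup>2 + 1)\<close> is the conformal factor of the stereographic
  parametrization; it satisfies \<open>dh(v) = - h\<^sup>2 \<langle>x, v\<rangle>\<close>.\<close>
definition stereo_param_deriv :: "real \<Rightarrow> 'e::euclidean_space \<Rightarrow> 'e \<Rightarrow> 'e \<times> real" where
  "stereo_param_deriv \<epsilon> x v =
     (let h = 2 / (x \<bullet> x + 1) in (h *\<^sub>R v - (h\<^sup>2 * (x \<bullet> v)) *\<^sub>R x, \<epsilon> * (h\<^sup>2 * (x \<bullet> v))))"

lemma conformal_factor_has_derivative:
  "((\<lambda>x. 2 / (x \<bullet> x + 1)) has_derivative (\<lambda>v. - ((2 / (x \<bullet> x + 1))\<^sup>2 * (x \<bullet> v)))) (at x)"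
  for x :: "'e::euclidean_space"
  using denominator_pos[of x]
  by (auto intro!: derivative_eq_intros simp: inner_commute field_simps power2_eq_square)

lemma stereo_param_has_derivative:
  "(stereo_param \<epsilon> has_derivative stereo_param_deriv \<epsilon> x) (at x)"
  unfolding stereo_param_def stereo_param_deriv_def Let_def
  by (rule derivative_eq_intros conformal_factor_has_derivative refl)+
     (auto simp: fun_eq_iff algebra_simps)

definition stereo_deriv :: "real \<Rightarrow> 'e::euclidean_space \<times> real \<Rightarrow> 'e \<times> real \<Rightarrow> 'e" where
  "stereo_deriv \<epsilon> p w =
     (1 / (1 - \<epsilon> * snd p)) *\<^sub>R fst w + (\<epsilon> * snd w / (1 - \<epsilon> * snd p)\<^sup>2) *\<^sub>R fst p"

lemma stereo_has_derivative:
  assumes "1 - \<epsilon> * snd p \<noteq> 0"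
  shows "(stereo \<epsilon> has_derivative stereo_deriv \<epsilon> p) (at p)"
  unfolding stereo_def stereo_deriv_def
  by (rule derivative_eq_intros refl assms)+
     (use assms in \<open>auto simp: fun_eq_iff field_simps power2_eq_square\<close>)

lemma stereo_param_deriv_tangent:
  assumes "\<epsilon> * \<epsilon> = 1"
  shows "stereo_param_deriv \<epsilon> x v \<bullet> stereo_param \<epsilon> x = 0"
proof -
  define h where "h = 2 / (x \<bullet> x + 1)"
  have h: "h * (x \<bullet> x) = 2 - h"
    using denominator_pos[of x] by (auto simp: h_def field_simps)
  have "stereo_param_deriv \<epsilon> x v \<bullet> stereo_param \<epsilon> x =
      h * h * (x \<bullet> v) - h * h * (x \<bullet> v) * (h * (x \<bullet> x)) + (\<epsilon> * \<epsilon>) * (h * h * (x \<bullet> v)) * (1 - h)"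
    unfolding stereo_param_def stereo_param_deriv_def Let_def h_def[symmetric] inner_Pair
    by (simp add: inner_diff_left power2_eq_square inner_commute algebra_simps)
  also have "\<dots> = 0" unfolding h assms by algebra
  finally show ?thesis .
qed

text \<open>The projection is differentiable on a neighbourhood of the punctured sphere in the ambient
  space, and its derivative there is a right inverse of the derivative of the parametrization on
  tangent vectors of the sphere.  With this, tangent vectors can be moved freely between charts
  and the ambient space.\<close>
lemma stereo_param_deriv_stereo_deriv:
  assumes \<epsilon>: "\<epsilon> * \<epsilon> = 1" and w: "w \<bullet> stereo_param \<epsilon> x = 0"
  shows "stereo_param_deriv \<epsilon> x (stereo_deriv \<epsilon> (stereo_param \<epsilon> x) w) = w"
proof -
  obtain a b where ab: "w = (a, b)" by fastforce
  define h where "h = 2 / (x \<bullet> x + 1)"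
  have h: "h * (x \<bullet> x) = 2 - h" "h \<noteq> 0"
    using denominator_pos[of x] by (auto simp: h_def field_simps)
  have den: "1 - \<epsilon> * (\<epsilon> * (1 - h)) = h" using \<epsilon> by algebra
  have par: "stereo_param \<epsilon> x = (h *\<^sub>R x, \<epsilon> * (1 - h))"
    by (simp add: stereo_param_def h_def)
  have v: "stereo_deriv \<epsilon> (stereo_param \<epsilon> x) w = (1 / h) *\<^sub>R a + (\<epsilon> * b / h) *\<^sub>R x"
    using h by (simp add: ab stereo_deriv_def par den power2_eq_square)
  have "h * (x \<bullet> a) = - \<epsilon> * (1 - h) * b"
    using w by (simp add: ab par inner_commute algebra_simps)
  then have "h * (h * (x \<bullet> stereo_deriv \<epsilon> (stereo_param \<epsilon> x) w)) = \<epsilon> * b"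
    using h unfolding v inner_add_right inner_scaleR_right by (simp add: field_simps) algebra
  then have xv: "h\<^sup>2 * (x \<bullet> stereo_deriv \<epsilon> (stereo_param \<epsilon> x) w) = \<epsilon> * b"
    by (simp add: power2_eq_square)
  have "\<epsilon> * (\<epsilon> * b) = b" using \<epsilon> by algebra
  moreover have "h *\<^sub>R stereo_deriv \<epsilon> (stereo_param \<epsilon> x) w - (\<epsilon> * b) *\<^sub>R x = a"
    using h unfolding v by (simp add: scaleR_add_right)
  ultimately show ?thesis
    unfolding stereo_param_deriv_def Let_def h_def[symmetric] xv by (simp add: ab)
qed

lemma param_stereo_chart:
  assumes "\<epsilon> * \<epsilon> = 1"
  shows "param (stereo_chart \<epsilon>) = stereo_param \<epsilon>"
proof
  fix x :: "'e::euclidean_space"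
  have "inj_on (stereo \<epsilon>) (sphere 0 1 - {(0 :: 'e, \<epsilon>)})"
    using stereo_param_stereo[OF assms] by (rule inj_on_inverseI)
  then show "param (stereo_chart \<epsilon>) x = stereo_param \<epsilon> x"
    unfolding param_def stereo_chart_def fst_conv snd_conv
    using stereo_param_in_chart[OF assms] stereo_stereo_param[OF assms] by (rule inv_into_f_eq)
qed

lemma stereo_atlasE:
  assumes "c \<in> stereo_atlas"
  obtains \<epsilon> where "\<epsilon> * \<epsilon> = 1" "fst c = sphere 0 1 - {(0, \<epsilon>)}" "snd c = stereo \<epsilon>"
    "param c = stereo_param \<epsilon>"
proof -
  obtain \<epsilon> where "\<epsilon> * \<epsilon> = 1" "c = stereo_chart \<epsilon>"
    using assms unfolding stereo_atlas_def
    by (metis empty_iff insert_iff minus_mult_minus mult_1)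
  then show thesis
    using that[of \<epsilon>] param_stereo_chart[of \<epsilon>] by (simp add: stereo_chart_def)
qed

context
  fixes c :: "('e::euclidean_space \<times> real, 'e) chart"
  assumes c: "c \<in> stereo_atlas"
begin

lemma param_in_chart: "param c x \<in> fst c"
proof -
  from c obtain \<epsilon> where "\<epsilon> * \<epsilon> = 1" "fst c = sphere 0 1 - {(0, \<epsilon>)}" "param c = stereo_param \<epsilon>"
    by (rule stereo_atlasE)
  then show ?thesis using stereo_param_in_chart by metis
qed

lemma chart_subset_sphere: "fst c \<subseteq> sphere 0 1"
proof -
  from c obtain \<epsilon> where "fst c = sphere 0 1 - {(0, \<epsilon>)}" by (rule stereo_atlasE)
  then show ?thesis by blast
qed

lemma openin_chart: "openin (top_of_set (sphere 0 1)) (fst c)"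
proof -
  from c obtain \<epsilon> where "fst c = sphere 0 1 - {(0, \<epsilon>)}" by (rule stereo_atlasE)
  then show ?thesis by (simp add: openin_delete)
qed

lemma param_in_sphere: "param c x \<in> sphere 0 1"
  using param_in_chart chart_subset_sphere by blast

lemma chart_param: "snd c (param c x) = x"
proof -
  from c obtain \<epsilon> where "\<epsilon> * \<epsilon> = 1" "snd c = stereo \<epsilon>" "param c = stereo_param \<epsilon>"
    by (rule stereo_atlasE)
  then show ?thesis using stereo_stereo_param by metis
qed

lemma param_chart: "p \<in> fst c \<Longrightarrow> param c (snd c p) = p"
proof -
  assume p: "p \<in> fst c"
  from c obtain \<epsilon> where "\<epsilon> * \<epsilon> = 1" "fst c = sphere 0 1 - {(0, \<epsilon>)}" "snd c = stereo \<epsilon>"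
      "param c = stereo_param \<epsilon>"
    by (rule stereo_atlasE)
  then show ?thesis using stereo_param_stereo p by metis
qed

lemma chart_image_Int: "snd c ` (fst c \<inter> X) = {x. param c x \<in> X}"
proof (intro equalityI subsetI)
  fix x assume "x \<in> snd c ` (fst c \<inter> X)"
  then obtain p where "p \<in> fst c" "p \<in> X" "x = snd c p" by blast
  then show "x \<in> {x. param c x \<in> X}" by (simp add: param_chart)
next
  fix x assume "x \<in> {x. param c x \<in> X}"
  then have "param c x \<in> fst c \<inter> X" using param_in_chart by simp
  then have "snd c (param c x) \<in> snd c ` (fst c \<inter> X)" by (rule imageI)
  then show "x \<in> snd c ` (fst c \<inter> X)" by (simp add: chart_param)
qed

lemma chart_image: "snd c ` fst c = UNIV"
  using chart_image_Int[of UNIV] by simp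

lemma param_has_derivative:
  "(param c has_derivative frechet_derivative (param c) (at x)) (at x)"
proof -
  from c obtain \<epsilon> where "param c = stereo_param \<epsilon>" by (rule stereo_atlasE)
  then show ?thesis
    using stereo_param_has_derivative frechet_derivative_works differentiableI by metis
qed

lemma chart_has_derivative:
  assumes "p \<in> fst c"
  shows "(snd c has_derivative frechet_derivative (snd c) (at p)) (at p)"
proof -
  from c obtain \<epsilon> where \<epsilon>: "\<epsilon> * \<epsilon> = 1" "fst c = sphere 0 1 - {(0, \<epsilon>)}" "snd c = stereo \<epsilon>"
    by (rule stereo_atlasE)
  have "1 - \<epsilon> * snd p \<noteq> 0" using assms \<epsilon> stereo_denominator by metis
  from stereo_has_derivative[OF this] show ?thesis
    unfolding \<epsilon>(3) using frechet_derivative_works differentiableI by metis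
qed

lemma param_derivative_tangent: "frechet_derivative (param c) (at x) v \<bullet> param c x = 0"
proof -
  from c obtain \<epsilon> where \<epsilon>: "\<epsilon> * \<epsilon> = 1" "param c = stereo_param \<epsilon>" by (rule stereo_atlasE)
  then show ?thesis
    using stereo_param_deriv_tangent[OF \<epsilon>(1)]
    by (simp flip: frechet_derivative_at[OF stereo_param_has_derivative])
qed

lemma param_derivative_chart_derivative:
  assumes "w \<bullet> param c x = 0"
  shows "frechet_derivative (param c) (at x) (frechet_derivative (snd c) (at (param c x)) w) = w"
proof -
  from c obtain \<epsilon> where \<epsilon>: "\<epsilon> * \<epsilon> = 1" "snd c = stereo \<epsilon>" "param c = stereo_param \<epsilon>"
    by (rule stereo_atlasE)
  have "1 - \<epsilon> * snd (stereo_param \<epsilon> x) \<noteq> 0"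
    by (rule stereo_denominator[OF \<epsilon>(1) stereo_param_in_chart[OF \<epsilon>(1)]])
  note ders = stereo_has_derivative[OF this, THEN frechet_derivative_at]
    stereo_param_has_derivative[THEN frechet_derivative_at]
  show ?thesis
    using stereo_param_deriv_stereo_deriv[OF \<epsilon>(1)] assms
    unfolding \<epsilon> by (simp flip: ders)
qed

lemma smooth_param: "open S \<Longrightarrow> smooth_on S (param c)"
proof -
  assume S: "open S"
  from c obtain \<epsilon> where \<epsilon>: "param c = stereo_param \<epsilon>" by (rule stereo_atlasE)
  have nz: "x \<bullet> x + 1 \<noteq> (0 :: real)" for x :: 'e using denominator_pos[of x] by simp
  show ?thesis
    unfolding \<epsilon> stereo_param_def by (intro smooth_intros S nz)
qed

lemma smooth_param_derivative:
  assumes S: "open S" and V: "smooth_on S V"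
  shows "smooth_on S (\<lambda>x. frechet_derivative (param c) (at x) (V x))"
proof -
  from c obtain \<epsilon> where \<epsilon>: "param c = stereo_param \<epsilon>" by (rule stereo_atlasE)
  have nz: "x \<bullet> x + 1 \<noteq> (0 :: real)" for x :: 'e using denominator_pos[of x] by simp
  have "smooth_on S (\<lambda>x. stereo_param_deriv \<epsilon> x (V x))"
    unfolding stereo_param_deriv_def Let_def by (intro smooth_intros S V nz)
  then show ?thesis
    unfolding \<epsilon> by (simp flip: frechet_derivative_at[OF stereo_param_has_derivative])
qed

lemma smooth_chart_derivative:
  assumes S: "open S" and V: "smooth_on S V"
  shows "smooth_on S (\<lambda>x. frechet_derivative (snd c) (at (param c x)) (V x))"
proof -
  from c obtain \<epsilon> where \<epsilon>: "\<epsilon> * \<epsilon> = 1" "snd c = stereo \<epsilon>" "param c = stereo_param \<epsilon>"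
    by (rule stereo_atlasE)
  have nz: "1 - \<epsilon> * snd (param c x) \<noteq> 0" for x :: 'e
    unfolding \<epsilon>(3) by (rule stereo_denominator[OF \<epsilon>(1) stereo_param_in_chart[OF \<epsilon>(1)]])
  have "smooth_on S (\<lambda>x. stereo_deriv \<epsilon> (param c x) (V x))"
    unfolding stereo_deriv_def by (intro smooth_intros S V smooth_param nz power_not_zero)
  then show ?thesis
    unfolding \<epsilon>(2) by (simp flip: frechet_derivative_at[OF stereo_has_derivative[OF nz]])
qed

lemma continuous_on_param: "continuous_on S (param c)"
  by (rule has_derivative_continuous_on[OF has_derivative_at_withinI[OF param_has_derivative]])

lemma continuous_on_chart: "continuous_on (fst c) (snd c)"
  by (rule has_derivative_continuous_on[OF has_derivative_at_withinI[OF chart_has_derivative]])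

end

lemma stereo_atlas_cover: "(\<Union>c\<in>stereo_atlas. fst c) = sphere 0 1"
  by (auto simp: stereo_atlas_def stereo_chart_def)

text \<open>The chain rule applies because the projection in \<open>d\<close> is differentiable as a map on an open
  subset of the ambient space.\<close>
lemma transition_has_derivative:
  assumes c: "c \<in> stereo_atlas" and d: "d \<in> stereo_atlas" and p: "p \<in> fst c \<inter> fst d"
  shows "(transition c d has_derivative
     (\<lambda>v. frechet_derivative (snd d) (at p) (frechet_derivative (param c) (at (snd c p)) v)))
     (at (snd c p))"
proof -
  have "(snd d has_derivative frechet_derivative (snd d) (at p)) (at (param c (snd c p)))"
    using chart_has_derivative[OF d] p param_chart[OF c] by auto
  from diff_chain_at[OF param_has_derivative[OF c] this] show ?thesis
    by (simp add: transition_def o_def)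
qed

text \<open>Two charts describe the same ambient tangent vector; all compatibility conditions for
  vector fields and forms reduce to this identity.\<close>
lemma param_derivative_transition:
  assumes c: "c \<in> stereo_atlas" and d: "d \<in> stereo_atlas" and p: "p \<in> fst c \<inter> fst d"
  shows "frechet_derivative (param d) (at (snd d p)) (frechet_derivative (transition c d) (at (snd c p)) v)
    = frechet_derivative (param c) (at (snd c p)) v"
  using p param_derivative_tangent[OF c, of "snd c p" v]
    param_derivative_chart_derivative[OF d, of _ "snd d p"]
  by (simp add: param_chart c d flip: frechet_derivative_at[OF transition_has_derivative[OF assms]])

lemma second_countable_euclidean: "second_countable (euclidean :: 'a::second_countable_topology topology)"
proof -
  obtain B :: "'a set set" where "countable B" "topological_basis B"
    using ex_countable_basis by blast
  then show ?thesis
    unfolding second_countable_def by (metis open_openin topological_basisE topological_basis_open)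
qed

lemma sphere_smooth_manifold:
  "smooth_manifold (top_of_set (sphere 0 1 :: ('e::euclidean_space \<times> real) set)) stereo_atlas"
proof -
  let ?S = "sphere 0 1 :: ('e \<times> real) set"
  have chart: "openin (top_of_set ?S) (fst c) \<and> open (snd c ` fst c) \<and>
      homeomorphic_map (subtopology (top_of_set ?S) (fst c)) (top_of_set (snd c ` fst c)) (snd c)"
    if c: "c \<in> stereo_atlas" for c :: "('e \<times> real, 'e) chart"
  proof (intro conjI)
    show "openin (top_of_set ?S) (fst c)" by (rule openin_chart[OF c])
    show "open (snd c ` fst c)" by (simp add: chart_image[OF c])
    have "param c ` UNIV = fst c"
      using param_in_chart[OF c] param_chart[OF c, symmetric] by (auto intro: range_eqI)
    then have "homeomorphic_maps (top_of_set (fst c)) (top_of_set (snd c ` fst c)) (snd c) (param c)"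
      unfolding homeomorphic_maps_def chart_image[OF c]
      using continuous_on_param[OF c] continuous_on_chart[OF c]
      by (auto simp: param_chart[OF c] chart_param[OF c] continuous_map_in_subtopology)
    moreover have "subtopology (top_of_set ?S) (fst c) = top_of_set (fst c)"
      using chart_subset_sphere[OF c] by (simp add: subtopology_subtopology inf_absorb2)
    ultimately show "homeomorphic_map (subtopology (top_of_set ?S) (fst c))
        (top_of_set (snd c ` fst c)) (snd c)"
      using homeomorphic_maps_map by metis
  qed
  have trans: "smooth_on (snd c ` (fst c \<inter> fst d)) (transition c d)"
    if c: "c \<in> stereo_atlas" and d: "d \<in> stereo_atlas" for c d :: "('e \<times> real, 'e) chart"
  proof -
    from d obtain \<epsilon> where \<epsilon>: "\<epsilon> * \<epsilon> = 1" "fst d = sphere 0 1 - {(0, \<epsilon>)}" "snd d = stereo \<epsilon>"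
      by (rule stereo_atlasE)
    let ?X = "snd c ` (fst c \<inter> fst d)"
    have X: "?X = param c -` (- {(0, \<epsilon>)})"
      using param_in_sphere[OF c] unfolding chart_image_Int[OF c] \<epsilon>(2) by auto
    have op: "open ?X" unfolding X
      by (intro open_vimage continuous_on_param[OF c]) auto
    have "smooth_on ?X (\<lambda>x. (1 / (1 - \<epsilon> * snd (param c x))) *\<^sub>R fst (param c x))"
    proof (intro smooth_intros op smooth_param[OF c])
      fix x assume "x \<in> ?X"
      then show "1 - \<epsilon> * snd (param c x) \<noteq> 0"
        using param_in_sphere[OF c] unfolding X by (intro stereo_denominator \<epsilon>) auto
    qed
    then show ?thesis
      by (simp add: transition_def \<epsilon>(3) stereo_def o_def)
  qed
  show ?thesis
    unfolding smooth_manifold_def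
    by (intro conjI ballI)
      (simp_all add: stereo_atlas_cover chart trans Hausdorff_space_subtopology second_countable_subtopology
        second_countable_euclidean)
qed

text \<open>Symmetry of the second derivative is what makes the second-order terms cancel in the
  exterior derivative of a pulled back form.\<close>
lemma stereo_param_second_derivative:
  fixes x :: "'e::euclidean_space"
  shows "\<exists>H. (\<forall>v. ((\<lambda>y. stereo_param_deriv \<epsilon> y v) has_derivative H v) (at x)) \<and>
    (\<forall>v w. H v w = H w v)"
proof -
  define h where "h y = 2 / (y \<bullet> y + 1)" for y :: 'e
  define G where "G v w = h x ^ 2 * (v \<bullet> w) - 2 * h x ^ 3 * (x \<bullet> w) * (x \<bullet> v)" for v w
  define H where "H v w =
    (- (h x ^ 2 * (x \<bullet> w)) *\<^sub>R v - G v w *\<^sub>R x - (h x ^ 2 * (x \<bullet> v)) *\<^sub>R w, \<epsilon> * G v w)" for v w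
  have h: "(h has_derivative (\<lambda>w. - (h x ^ 2 * (x \<bullet> w)))) (at x)"
    unfolding h_def by (rule conformal_factor_has_derivative)
  have G: "((\<lambda>y. h y ^ 2 * (y \<bullet> v)) has_derivative G v) (at x)" for v
    by (rule derivative_eq_intros h refl)+
      (simp add: G_def fun_eq_iff power2_eq_square power3_eq_cube inner_commute algebra_simps)
  have "((\<lambda>y. (h y *\<^sub>R v - (h y ^ 2 * (y \<bullet> v)) *\<^sub>R y, \<epsilon> * (h y ^ 2 * (y \<bullet> v)))) has_derivative H v) (at x)" for v
    by (rule derivative_eq_intros h G refl)+
      (simp add: H_def fun_eq_iff algebra_simps)
  moreover have "H v w = H w v" for v w
    by (simp add: H_def G_def inner_commute algebra_simps)
  ultimately show ?thesis
    unfolding stereo_param_deriv_def Let_def h_def by blast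
qed

lemma param_second_derivative:
  assumes "c \<in> stereo_atlas"
  shows "\<exists>H. (\<forall>v. ((\<lambda>y. frechet_derivative (param c) (at y) v) has_derivative H v) (at x)) \<and>
    (\<forall>v w. H v w = H w v)"
proof -
  from assms obtain \<epsilon> where "param c = stereo_param \<epsilon>" by (rule stereo_atlasE)
  then show ?thesis
    using stereo_param_second_derivative[of \<epsilon> x]
    by (simp flip: frechet_derivative_at[OF stereo_param_has_derivative])
qed

lemma height_defining_function:
  "defining_function (top_of_set (sphere 0 1 :: ('e::euclidean_space \<times> real) set)) stereo_atlas snd"
  unfolding defining_function_def
proof (intro conjI ballI)
  show "snd \<in> smooth_funs (stereo_atlas :: ('e \<times> real, 'e) chart set)"
    unfolding smooth_funs_def o_def
    by (simp add: chart_image) (intro ballI smooth_intros smooth_param open_UNIV)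
  fix c :: "('e \<times> real, 'e) chart" and p
  assume c: "c \<in> stereo_atlas"
    and p: "p \<in> fst c \<inter> critical_set (top_of_set (sphere 0 1 :: ('e \<times> real) set)) snd"
  then have z: "snd (param c (snd c p)) = 0" by (simp add: param_chart critical_set_def)
  let ?x = "snd c p"
  have der: "(snd \<circ> param c has_derivative snd \<circ> frechet_derivative (param c) (at ?x)) (at ?x)"
    using has_derivative_snd[OF param_has_derivative[OF c]] by (simp add: o_def)
  let ?w = "(0, 1) :: 'e \<times> real"
  have "?w \<bullet> param c ?x = 0" using z by (simp add: inner_prod_def)
  from param_derivative_chart_derivative[OF c this]
  have "(snd \<circ> frechet_derivative (param c) (at ?x))
      (frechet_derivative (snd c) (at (param c ?x)) ?w) = 1" by simp
  then show "frechet_derivative (snd \<circ> param c) (at ?x) \<noteq> (\<lambda>_. 0)"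
    unfolding frechet_derivative_at[OF der, symmetric] by (metis zero_neq_one)
qed

section \<open>The contact form\<close>

locale bm_contact_sphere =
  fixes J :: "'e::euclidean_space \<times> real \<Rightarrow> 'e \<times> real" and m :: nat
  assumes linear_J: "linear J"
    and J_J: "J (J v) = - v"
    and J_skew: "J v \<bullet> w = - (v \<bullet> J w)"
    and m_pos: "m \<ge> 1"
begin

definition pole :: "'e \<times> real" where "pole = (0, 1)"

text \<open>Ambient \<open>b\<^sup>m\<close>-vectors are written in the frame in which the last basis vector \<open>\<partial>\<^sub>s\<close> is
  replaced by \<open>s^m \<partial>\<^sub>s\<close>.  The anchor map below turns the coefficients in this frame into an
  ordinary vector.  In these terms \<open>normal\<close> is the covector \<open>d(|p|\<^sup>2)/2\<close>, \<open>covector\<close> is the form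
  \<open>\<alpha>\<close>, and \<open>liouville\<close> is the vector dual to \<open>\<alpha>\<close> under the symplectic form
  \<open>\<Omega>(v, w) = \<langle>J v, w\<rangle>\<close>.  The formulas are those of the introduction, rewritten by separating off
  \<open>1/2 \<langle>J p, _\<rangle>\<close>, which extends \<open>\<lambda>\<close> to the whole space; this avoids splitting off
  the \<open>(s, y)\<close>-plane.\<close>
definition normal :: "'e \<times> real \<Rightarrow> 'e \<times> real" where
  "normal p = (fst p, snd p ^ (m + 1))"

definition covector :: "'e \<times> real \<Rightarrow> 'e \<times> real" where
  "covector p = (1 / 2) *\<^sub>R J p + (snd p ^ (m + 1) / (m + 1) - snd p / 2) *\<^sub>R J pole
     - ((J pole \<bullet> p) * (1 / 2 - snd p ^ (2 * m))) *\<^sub>R pole"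

definition liouville :: "'e \<times> real \<Rightarrow> 'e \<times> real" where
  "liouville p = (1 / 2) *\<^sub>R p + (snd p ^ (m + 1) / (m + 1) - snd p / 2) *\<^sub>R pole
     + ((J pole \<bullet> p) * (1 / 2 - snd p ^ (2 * m))) *\<^sub>R J pole"

definition anchor :: "'e \<times> real \<Rightarrow> 'e \<times> real \<Rightarrow> 'e \<times> real" where
  "anchor p w = (fst w, snd p ^ m * snd w)"

text \<open>On the critical set, where the anchor map is not injective, this is a junk value.\<close>
definition unanchor :: "'e \<times> real \<Rightarrow> 'e \<times> real \<Rightarrow> 'e \<times> real" where
  "unanchor p w = (fst w, snd w / snd p ^ m)"

definition contact_form :: "('e \<times> real, 'e) form" where
  "contact_form c x v =
     covector (param c x) \<bullet> unanchor (param c x) (frechet_derivative (param c) (at x) (v 0))"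

definition tangent_field :: "('e \<times> real \<Rightarrow> 'e \<times> real) \<Rightarrow> ('e \<times> real, 'e) vfield" where
  "tangent_field V c x =
     frechet_derivative (snd c) (at (param c x)) (anchor (param c x) (V (param c x)))"

text \<open>Contracting \<open>\<Omega>\<close> with \<open>J (normal p)\<close> gives \<open>- normal p\<close>, which vanishes on tangent vectors
  of the sphere; the factor normalises the pairing with \<open>\<alpha>\<close> to 1.\<close>
definition reeb :: "'e \<times> real \<Rightarrow> 'e \<times> real" where
  "reeb p = (1 / (liouville p \<bullet> normal p)) *\<^sub>R J (normal p)"

lemmas J_simps = linear_add[OF linear_J] linear_diff[OF linear_J] linear_cmul[OF linear_J]
  linear_neg[OF linear_J] linear_0[OF linear_J] J_J

lemma J_isometry: "J v \<bullet> J w = v \<bullet> w"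
  by (simp add: J_skew J_J)

lemma J_orthogonal: "J v \<bullet> v = 0" "v \<bullet> J v = 0"
  using J_skew[of v v] by (simp_all add: inner_commute)

lemma inner_pole: "v \<bullet> pole = snd v" "pole \<bullet> v = snd v"
  by (simp_all add: pole_def inner_prod_def)

lemma fst_pole [simp]: "fst pole = 0" and snd_pole [simp]: "snd pole = 1"
  by (simp_all add: pole_def)

lemma snd_J_pole: "snd (J pole) = 0"
  using J_orthogonal(1)[of pole] by (simp add: inner_pole)

lemma snd_J: "snd (J v) = - (J pole \<bullet> v)"
  using J_skew[of v pole] by (simp add: inner_pole inner_commute)

lemma J_liouville: "J (liouville p) = covector p"
  by (simp add: liouville_def covector_def J_simps)

lemma unanchor_eq:
  "unanchor p w = w + (snd w / snd p ^ m - snd w) *\<^sub>R pole"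
  by (simp add: unanchor_def prod_eq_iff)

lemma J_unanchor:
  "J (unanchor p u) \<bullet> unanchor p w = J u \<bullet> w
     + (snd u / snd p ^ m - snd u) * (J pole \<bullet> w) - (snd w / snd p ^ m - snd w) * (J pole \<bullet> u)"
  unfolding unanchor_eq
  by (simp add: J_simps inner_add_left inner_add_right inner_pole snd_J[of u] snd_J_pole J_orthogonal)

lemma unanchor_anchor: "snd p \<noteq> 0 \<Longrightarrow> unanchor p (anchor p w) = w"
  by (simp add: unanchor_def anchor_def)

lemma inner_anchor: "anchor p w \<bullet> p = w \<bullet> normal p"
  by (simp add: anchor_def normal_def inner_prod_def)

lemma inner_unanchor: "snd p \<noteq> 0 \<Longrightarrow> unanchor p w \<bullet> normal p = w \<bullet> p"
  by (simp add: unanchor_def normal_def inner_prod_def)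

text \<open>The pairing is \<open>(|q|\<^sup>2 - y\<^sup>2) / 2 + y\<^sup>2 (1 - s^(2m)) + s^(2m+2) / (m+1)\<close>, where \<open>p = (q, s)\<close>.  All
  summands are non-negative on the sphere.  For \<open>s \<noteq> 0\<close> the last one is positive; for \<open>s = 0\<close>
  the sum is \<open>(|q|\<^sup>2 + y\<^sup>2) / 2\<close> with \<open>|q| = 1\<close>.\<close>
lemma liouville_transverse:
  assumes "p \<in> sphere 0 1"
  shows "liouville p \<bullet> normal p > 0"
proof -
  define s where "s = snd p"
  define y where "y = J pole \<bullet> p"
  have norm: "fst p \<bullet> fst p + s * s = 1" using assms in_sphere_iff[of p] by (simp add: s_def)
  have y_fst: "y = fst (J pole) \<bullet> fst p" by (simp add: y_def inner_prod_def snd_J_pole)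
  have unit: "fst (J pole) \<bullet> fst (J pole) = 1"
    using J_isometry[of pole pole] by (simp add: inner_prod_def snd_J_pole)
  have y2: "y\<^sup>2 \<le> fst p \<bullet> fst p"
    using Cauchy_Schwarz_ineq[of "fst (J pole)" "fst p"] by (simp add: y_fst unit)
  have "s\<^sup>2 \<le> 1" using norm by (simp add: power2_eq_square) (metis inner_ge_zero add_increasing2 order_refl add.commute)
  then have s2m: "s ^ (2 * m) \<le> 1" by (simp add: power_mult power_le_one)
  have eq: "liouville p \<bullet> normal p =
      (fst p \<bullet> fst p - y\<^sup>2) / 2 + y\<^sup>2 * (1 - s ^ (2 * m)) + (s ^ (m + 1))\<^sup>2 / (m + 1)"
    by (simp add: liouville_def normal_def inner_prod_def snd_J_pole inner_add_left y_fst[symmetric] y_def[symmetric]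
        s_def[symmetric] power2_eq_square algebra_simps add_divide_distrib diff_divide_distrib)
  show ?thesis
  proof (cases "s = 0")
    case True
    then have "s ^ (2 * m) = 0" using m_pos by (simp add: zero_power)
    then show ?thesis using y2 norm True unfolding eq by (cases "y = 0") (auto simp: add_pos_nonneg add_nonneg_pos zero_power)
  next
    case False
    then have "(s ^ (m + 1))\<^sup>2 / (m + 1) > 0" by simp
    moreover have "y\<^sup>2 * (1 - s ^ (2 * m)) \<ge> 0" using s2m by simp
    moreover have "(fst p \<bullet> fst p - y\<^sup>2) / 2 \<ge> 0" using y2 by simp
    ultimately show ?thesis unfolding eq by linarith
  qed
qed

section \<open>The exterior derivative\<close>

text \<open>Off the equator \<open>\<alpha> = \<langle>A, _\<rangle>\<close> for an ordinary vector-valued function \<open>A\<close>.  The product rule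
  expresses the derivative of \<open>\<langle>A(\<phi>), D\<phi> v\<rangle>\<close> by \<open>DA\<close> and \<open>D\<^sup>2\<phi>\<close>.  After antisymmetrization the
  terms with \<open>D\<^sup>2\<phi>\<close> drop out, and \<open>DA\<close> leaves the constant form \<open>\<Omega>\<close> in the \<open>b\<^sup>m\<close>-frame.\<close>
lemma ext_deriv_contact_form:
  assumes c: "c \<in> stereo_atlas" and z: "snd (param c x) \<noteq> 0"
  shows "ext_deriv 1 contact_form c x v =
    J (unanchor (param c x) (frechet_derivative (param c) (at x) (v 0))) \<bullet>
      unanchor (param c x) (frechet_derivative (param c) (at x) (v 1))"
proof -
  define \<phi> where "\<phi> = param c"
  define D where "D y = frechet_derivative \<phi> (at y)" for y
  define p where "p = \<phi> x"
  define s where "s = snd p"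
  have s: "s \<noteq> 0" using z by (simp add: s_def p_def \<phi>_def)
  obtain H where H: "\<And>u. ((\<lambda>y. D y u) has_derivative H u) (at x)" and sym: "\<And>u w. H u w = H w u"
    using param_second_derivative[OF c, of x] unfolding D_def \<phi>_def by blast
  \<comment> \<open>The coefficient of \<open>y ds\<close> in \<open>\<alpha>\<close>, shifted by the one that \<open>1/2 \<langle>J p, _\<rangle>\<close> contains.\<close>
  define k where "k t = 1 / 2 - inverse (t ^ m) + t ^ m" for t :: real
  define A where "A q = (1 / 2) *\<^sub>R J q + (snd q ^ (m + 1) / (m + 1) - snd q / 2) *\<^sub>R J pole
      + (k (snd q) * (J pole \<bullet> q)) *\<^sub>R pole" for q
  have form: "covector q \<bullet> unanchor q w = A q \<bullet> w" if "snd q \<noteq> 0" for q w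
  proof -
    have t: "snd q ^ m \<noteq> 0" "snd q ^ (2 * m) = snd q ^ m * snd q ^ m"
      using that by (simp_all add: mult_2 power_add)
    have "J q \<bullet> unanchor q w = J q \<bullet> w - (snd w / snd q ^ m - snd w) * (J pole \<bullet> q)"
      unfolding unanchor_eq inner_add_right inner_scaleR_right inner_pole snd_J[of q] by simp
    moreover have "J pole \<bullet> unanchor q w = J pole \<bullet> w"
      unfolding unanchor_eq inner_add_right inner_scaleR_right inner_pole snd_J_pole by simp
    moreover have "snd (unanchor q w) = snd w / snd q ^ m"
      by (simp add: unanchor_def)
    moreover have "(1 / 2) * (a - (b * r - b) * y) + e * f - (y * (1 / 2 - t * t)) * (b * r)
        = (1 / 2) * a + e * f + ((1 / 2 - r + t) * y) * b"
      if "t * r = 1" for a b e f r t y :: real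
      using that by algebra
    note this[of "snd q ^ m" "inverse (snd q ^ m)"]
    ultimately show ?thesis
      unfolding covector_def A_def k_def inner_add_left inner_diff_left inner_scaleR_left inner_pole t(2)
        divide_inverse[of "snd w"]
      using t(1) by simp
  qed
  define k' where "k' = inverse (s ^ m) * (m * s ^ (m - 1)) * inverse (s ^ m) + m * s ^ (m - 1)"
  have pow: "((\<lambda>t. t ^ m) has_real_derivative m * s ^ (m - 1)) (at s)"
    using DERIV_pow[of m s] by simp
  have "(k has_real_derivative 0 - - (inverse (s ^ m) * (m * s ^ (m - 1)) * inverse (s ^ m)) + m * s ^ (m - 1)) (at s)"
    unfolding k_def by (intro DERIV_add DERIV_diff DERIV_const DERIV_inverse' pow) (use s in simp)
  then have "(k has_real_derivative k') (at s)" by (simp add: k'_def)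
  then have k': "(k has_derivative (\<lambda>t. k' * t)) (at (snd p))"
    by (simp add: has_field_derivative_def s_def)
  have lin: "(J has_derivative J) (at p)"
    using linear_J by (simp add: linear_conv_bounded_linear bounded_linear_imp_has_derivative)
  define DA where "DA w = (1 / 2) *\<^sub>R J w + (s ^ m * snd w - snd w / 2) *\<^sub>R J pole
      + (k s * (J pole \<bullet> w) + k' * snd w * (J pole \<bullet> p)) *\<^sub>R pole" for w
  have ks: "((\<lambda>q. k (snd q)) has_derivative (\<lambda>w. k' * snd w)) (at p)"
    using diff_chain_at[OF has_derivative_snd[OF has_derivative_ident] k'] by (simp add: o_def)
  have "((\<lambda>t. t ^ (m + 1) / (m + 1) - t / 2) has_real_derivative
      (m + 1) * s ^ m / (m + 1) - 1 / 2) (at s)"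
    using DERIV_pow[of "m + 1" s] by (intro DERIV_diff DERIV_cdivide DERIV_ident) simp
  then have "((\<lambda>t. t ^ (m + 1) / (m + 1) - t / 2) has_derivative (\<lambda>t. (s ^ m - 1 / 2) * t)) (at (snd p))"
    by (simp add: has_field_derivative_def s_def)
  then have coeff: "((\<lambda>q. snd q ^ (m + 1) / (m + 1) - snd q / 2) has_derivative
      (\<lambda>w. (s ^ m - 1 / 2) * snd w)) (at p)"
    using diff_chain_at[OF has_derivative_snd[OF has_derivative_ident]] by (fastforce simp: o_def)
  have A: "(A has_derivative DA) (at p)"
    unfolding A_def
    by (rule has_derivative_eq_rhs, rule has_derivative_add[OF has_derivative_add[OF
          has_derivative_scaleR_right[OF lin] has_derivative_scaleR_left[OF coeff]]
          has_derivative_scaleR_left[OF has_derivative_mult[OF ks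
          has_derivative_inner_right[OF has_derivative_ident]]]])
      (simp add: DA_def fun_eq_iff s_def algebra_simps)
  have \<phi>: "(\<phi> has_derivative D x) (at x)"
    unfolding \<phi>_def D_def by (rule param_has_derivative[OF c])
  have A\<phi>: "((\<lambda>y. A (\<phi> y)) has_derivative (\<lambda>w. DA (D x w))) (at x)"
    using diff_chain_at[OF \<phi> A[unfolded p_def]] by (simp add: o_def)
  have "open (\<phi> -` {q. snd q \<noteq> 0})"
    unfolding \<phi>_def by (intro open_vimage continuous_on_param[OF c] open_Collect_neq continuous_intros)
  then have op: "open {y. snd (\<phi> y) \<noteq> 0}" by (simp add: vimage_def)
  have der: "((\<lambda>y. contact_form c y u) has_derivative
      (\<lambda>w. A p \<bullet> H (u 0) w + DA (D x w) \<bullet> D x (u 0))) (at x)" for u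
  proof (rule has_derivative_transform_within_open[OF _ op])
    show "((\<lambda>y. A (\<phi> y) \<bullet> D y (u 0)) has_derivative
        (\<lambda>w. A p \<bullet> H (u 0) w + DA (D x w) \<bullet> D x (u 0))) (at x)"
      unfolding p_def by (rule has_derivative_inner[OF A\<phi> H])
    show "x \<in> {y. snd (\<phi> y) \<noteq> 0}" using s by (simp add: s_def p_def)
    fix y assume "y \<in> {y. snd (\<phi> y) \<noteq> 0}"
    then show "A (\<phi> y) \<bullet> D y (u 0) = contact_form c y u"
      unfolding contact_form_def using form[of "\<phi> y"] by (simp add: \<phi>_def D_def)
  qed
  have DA_inner: "DA u \<bullet> w = (1 / 2) * (J u \<bullet> w) + (s ^ m * snd u - snd u / 2) * (J pole \<bullet> w)
      + (k s * (J pole \<bullet> u) + k' * snd u * (J pole \<bullet> p)) * snd w" for u w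
    by (simp add: DA_def inner_add_left inner_pole)
  have skew: "J u \<bullet> w = - (J w \<bullet> u)" for u w
    by (subst J_skew) (simp add: inner_commute)
  have ext: "ext_deriv 1 contact_form c x v =
      frechet_derivative (\<lambda>y. contact_form c y (\<lambda>j. v (Suc j))) (at x) (v 0)
      - frechet_derivative (\<lambda>y. contact_form c y (\<lambda>j. if j < 1 then v j else v (Suc j))) (at x) (v 1)"
    by (simp add: ext_deriv_def)
  have "ext_deriv 1 contact_form c x v =
      (A p \<bullet> H (v 1) (v 0) + DA (D x (v 0)) \<bullet> D x (v 1))
      - (A p \<bullet> H (v 0) (v 1) + DA (D x (v 1)) \<bullet> D x (v 0))"
    unfolding ext frechet_derivative_at[OF der, symmetric] by simp
  also have "\<dots> = DA (D x (v 0)) \<bullet> D x (v 1) - DA (D x (v 1)) \<bullet> D x (v 0)"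
    using sym[of "v 0" "v 1"] by simp
  also have "\<dots> = J (unanchor p (D x (v 0))) \<bullet> unanchor p (D x (v 1))"
  proof -
    have "(1 / 2) * e + (t * a - a / 2) * g + ((1 / 2 - r + t) * f + l * a * y) * b
        - ((1 / 2) * (- e) + (t * b - b / 2) * f + ((1 / 2 - r + t) * g + l * b * y) * a)
        = e + (a * r - a) * g - (b * r - b) * f" for a b e f g l r t y :: real
      by algebra
    then show ?thesis
      unfolding DA_inner J_unanchor skew[of "D x (v 1)" "D x (v 0)"] k_def s_def[symmetric] divide_inverse[of _ "s ^ m"] .
  qed
  finally show ?thesis by (simp add: p_def D_def \<phi>_def)
qed

lemma contact_volume_contact_form:
  assumes c: "c \<in> stereo_atlas" and z: "snd (param c x) \<noteq> 0"
  shows "contact_volume n contact_form c x v =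
    wedge 1 (2 * n) (\<lambda>u. covector (param c x) \<bullet> u 0) (wedge_power 2 (\<lambda>u. J (u 0) \<bullet> u 1) n)
      (\<lambda>i. unanchor (param c x) (frechet_derivative (param c) (at x) (v i)))"
proof -
  let ?B = "\<lambda>w. unanchor (param c x) (frechet_derivative (param c) (at x) w)"
  have d: "ext_deriv 1 contact_form c x = (\<lambda>u. (\<lambda>u. J (u 0) \<bullet> u 1) (\<lambda>i. ?B (u i)))"
    using ext_deriv_contact_form[OF c z] by auto
  have a: "contact_form c x = (\<lambda>u. (\<lambda>u. covector (param c x) \<bullet> u 0) (\<lambda>i. ?B (u i)))"
    by (auto simp: contact_form_def)
  have w: "wedge_power 2 (ext_deriv 1 contact_form c x) n =
      (\<lambda>u. wedge_power 2 (\<lambda>u. J (u 0) \<bullet> u 1) n (\<lambda>i. ?B (u i)))"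
    unfolding d by (rule ext, rule wedge_power_compose)
  show ?thesis unfolding contact_volume_def w a by (rule wedge_compose)
qed

section \<open>Vector fields and the Reeb field\<close>

lemma param_derivative_tangent_field:
  assumes "c \<in> stereo_atlas" "V (param c x) \<bullet> normal (param c x) = 0"
  shows "frechet_derivative (param c) (at x) (tangent_field V c x) = anchor (param c x) (V (param c x))"
  unfolding tangent_field_def
  by (rule param_derivative_chart_derivative[OF assms(1)]) (simp add: inner_anchor assms(2))

text \<open>A function with values in the \<open>b\<^sup>m\<close>-frame that is annihilated by \<open>normal\<close> becomes tangent to
  the sphere after applying the anchor map, and the anchor map supplies the factor \<open>s^m\<close>.\<close>
lemma bm_vector_field_tangent_field:
  assumes smooth: "\<And>c. c \<in> stereo_atlas \<Longrightarrow> smooth_on UNIV (\<lambda>x. V (param c x))"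
    and tangent: "\<And>p. p \<in> sphere 0 1 \<Longrightarrow> V p \<bullet> normal p = 0"
  shows "bm_vector_field stereo_atlas snd m (tangent_field V)"
  unfolding bm_vector_field_def vector_field_def
proof (intro conjI ballI bexI[where x = "\<lambda>p. snd (V p)"])
  fix c :: "('e \<times> real, 'e) chart" assume c: "c \<in> stereo_atlas"
  show "smooth_on (snd c ` fst c) (tangent_field V c)"
    unfolding chart_image[OF c] tangent_field_def anchor_def
    by (intro smooth_chart_derivative[OF c] smooth_intros smooth[OF c] smooth_param[OF c] open_UNIV)
  fix d :: "('e \<times> real, 'e) chart" and p assume d: "d \<in> stereo_atlas" and p: "p \<in> fst c \<inter> fst d"
  have "V p \<bullet> normal p = 0" using p chart_subset_sphere[OF c] by (intro tangent) blast
  then have D: "frechet_derivative (param c) (at (snd c p)) (tangent_field V c (snd c p)) = anchor p (V p)"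
    using p param_derivative_tangent_field[OF c, of V "snd c p"] by (simp add: param_chart[OF c])
  show "tangent_field V d (snd d p) =
      frechet_derivative (transition c d) (at (snd c p)) (tangent_field V c (snd c p))"
    unfolding frechet_derivative_at[OF transition_has_derivative[OF c d p], symmetric] D
    using p by (simp add: tangent_field_def param_chart[OF d])
next
  fix c :: "('e \<times> real, 'e) chart" and p assume c: "c \<in> stereo_atlas" and p: "p \<in> fst c"
  have "V p \<bullet> normal p = 0" using p chart_subset_sphere[OF c] by (intro tangent) blast
  then have D: "frechet_derivative (param c) (at (snd c p)) (tangent_field V c (snd c p)) = anchor p (V p)"
    using p param_derivative_tangent_field[OF c, of V "snd c p"] by (simp add: param_chart[OF c])
  have "(snd \<circ> param c has_derivative snd \<circ> frechet_derivative (param c) (at (snd c p))) (at (snd c p))"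
    using has_derivative_snd[OF param_has_derivative[OF c]] by (simp add: o_def)
  from frechet_derivative_at[OF this, symmetric]
  show "frechet_derivative (snd \<circ> param c) (at (snd c p)) (tangent_field V c (snd c p)) =
      snd p ^ m * snd (V p)"
    by (simp add: D anchor_def)
next
  show "(\<lambda>p. snd (V p)) \<in> smooth_funs stereo_atlas"
    unfolding smooth_funs_def o_def
    by (simp add: chart_image) (intro ballI smooth_intros smooth open_UNIV)
qed

lemma smooth_on_J: "open S \<Longrightarrow> smooth_on S f \<Longrightarrow> smooth_on S (\<lambda>x. J (f x))"
  using smooth_on_bounded_linear linear_J linear_conv_bounded_linear by blast

lemma smooth_covector: "open S \<Longrightarrow> smooth_on S f \<Longrightarrow> smooth_on S (\<lambda>x. covector (f x))"
  unfolding covector_def by (intro smooth_intros smooth_on_J) auto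

lemma smooth_normal: "open S \<Longrightarrow> smooth_on S f \<Longrightarrow> smooth_on S (\<lambda>x. normal (f x))"
  unfolding normal_def by (intro smooth_intros)

lemma bm_vector_field_reeb: "bm_vector_field stereo_atlas snd m (tangent_field reeb)"
proof (rule bm_vector_field_tangent_field)
  show "reeb p \<bullet> normal p = 0" for p by (simp add: reeb_def J_orthogonal)
  fix c :: "('e \<times> real, 'e) chart" assume c: "c \<in> stereo_atlas"
  have nz: "liouville (param c x) \<bullet> normal (param c x) \<noteq> 0" for x
    using liouville_transverse[OF param_in_sphere[OF c]] by (metis less_irrefl)
  have "smooth_on UNIV (\<lambda>x. liouville (param c x))"
    unfolding liouville_def by (intro smooth_intros smooth_param[OF c] open_UNIV) auto
  then show "smooth_on UNIV (\<lambda>x. reeb (param c x))"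
    unfolding reeb_def
    by (intro smooth_intros smooth_on_J smooth_normal smooth_param[OF c] open_UNIV nz)
qed

lemma covector_reeb:
  assumes "p \<in> sphere 0 1"
  shows "covector p \<bullet> reeb p = 1"
  using liouville_transverse[OF assms] by (simp add: reeb_def J_isometry flip: J_liouville)

lemma reeb_field_reeb: "reeb_field stereo_atlas snd m contact_form (tangent_field reeb)"
  unfolding reeb_field_def
proof (intro conjI ballI impI allI)
  fix c :: "('e \<times> real, 'e) chart" and p
  assume c: "c \<in> stereo_atlas" and p: "p \<in> fst c" and z: "snd p \<noteq> 0"
  have S: "p \<in> sphere 0 1" using p chart_subset_sphere[OF c] by blast
  let ?D = "frechet_derivative (param c) (at (snd c p))"
  have D: "unanchor p (?D (tangent_field reeb c (snd c p))) = reeb p"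
    using param_derivative_tangent_field[OF c, of reeb "snd c p"] p z
    by (simp add: param_chart[OF c] reeb_def J_orthogonal unanchor_anchor)
  show "contact_form c (snd c p) (\<lambda>_. tangent_field reeb c (snd c p)) = 1"
    unfolding contact_form_def using covector_reeb[OF S] by (simp add: param_chart[OF c p] D)
  fix w
  have "?D w \<bullet> p = 0" using param_derivative_tangent[OF c, of "snd c p" w] by (simp add: param_chart[OF c p])
  then have "normal p \<bullet> unanchor p (?D w) = 0" using inner_unanchor[OF z, of "?D w"] by (simp add: inner_commute)
  then have "J (reeb p) \<bullet> unanchor p (?D w) = 0" by (simp add: reeb_def J_simps)
  then show "ext_deriv 1 contact_form c (snd c p)
      (\<lambda>i. if i = 0 then tangent_field reeb c (snd c p) else w) = 0"
    using z by (subst ext_deriv_contact_form[OF c]) (simp_all add: param_chart[OF c p] D)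
qed (rule bm_vector_field_reeb)

section \<open>Smoothness of the contact form across the equator\<close>

lemma form_on_contact_form: "form_on stereo_atlas (sphere 0 1 - {p. snd p = 0}) 1 contact_form"
  unfolding form_on_def
proof (intro conjI ballI allI)
  fix c :: "('e \<times> real, 'e) chart" assume c: "c \<in> stereo_atlas"
  have X: "snd c ` (fst c \<inter> (sphere 0 1 - {p. snd p = 0})) = param c -` {p. snd p \<noteq> 0}"
    using param_in_sphere[OF c] unfolding chart_image_Int[OF c] by auto
  {
    fix x
    let ?D = "frechet_derivative (param c) (at x)"
    have "linear ?D" using has_derivative_linear[OF param_has_derivative[OF c]] .
    then show "alternating 1 (contact_form c x)"
      unfolding alternating_def contact_form_def linear_iff
      by (auto simp: unanchor_def inner_prod_def inner_add_right algebra_simps add_divide_distrib)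
  next
    fix v
    have op: "open (param c -` {p. snd p \<noteq> 0})"
      by (intro open_vimage continuous_on_param[OF c] open_Collect_neq continuous_intros)
    show "smooth_on (snd c ` (fst c \<inter> (sphere 0 1 - {p. snd p = 0}))) (\<lambda>x. contact_form c x v)"
      unfolding X contact_form_def unanchor_def
      by (intro smooth_intros smooth_covector smooth_param[OF c] smooth_param_derivative[OF c] op) auto
  next
    fix d :: "('e \<times> real, 'e) chart" and p v
    assume d: "d \<in> stereo_atlas" and p: "p \<in> fst c \<inter> fst d \<inter> (sphere 0 1 - {p. snd p = 0})"
    then show "contact_form c (snd c p) v =
        contact_form d (snd d p) (\<lambda>i. frechet_derivative (transition c d) (at (snd c p)) (v i))"
      unfolding contact_form_def
      by (simp add: param_chart c d param_derivative_transition[OF c d])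
  }
qed

text \<open>For a \<open>b\<^sup>m\<close>-field with \<open>v(s) = s^m f\<close> the coefficients in the \<open>b\<^sup>m\<close>-frame are smooth: the last
  one is \<open>f\<close>.  Off the equator they are the unanchored values of the field, so pairing them with the
  smooth coefficients of \<open>\<alpha>\<close> gives the extension.\<close>
lemma contact_form_pairing:
  assumes "bm_vector_field stereo_atlas snd m (v 0)"
  shows "\<exists>g. bm_pairing stereo_atlas snd contact_form v g"
proof -
  let ?D = "\<lambda>c p. frechet_derivative (param c) (at (snd c p))"
  from assms obtain f where vf: "vector_field stereo_atlas (v 0)" and f: "f \<in> smooth_funs stereo_atlas"
    and df: "\<And>c p. c \<in> stereo_atlas \<Longrightarrow> p \<in> fst c \<Longrightarrow>
      frechet_derivative (snd \<circ> param c) (at (snd c p)) (v 0 c (snd c p)) = snd p ^ m * f p"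
    unfolding bm_vector_field_def by blast
  \<comment> \<open>a choice of a chart around each point, to define the ambient value \<open>W\<close> of the field globally\<close>
  define c0 :: "'e \<times> real \<Rightarrow> ('e \<times> real, 'e) chart"
    where "c0 p = (if p = (0, 1) then stereo_chart (-1) else stereo_chart 1)" for p
  have c0: "c0 p \<in> stereo_atlas" "p \<in> sphere 0 1 \<Longrightarrow> p \<in> fst (c0 p)" for p
    by (auto simp: c0_def stereo_atlas_def stereo_chart_def)
  define W where "W p = ?D (c0 p) p (v 0 (c0 p) (snd (c0 p) p))" for p
  have W: "?D c p (v 0 c (snd c p)) = W p" if c: "c \<in> stereo_atlas" and p: "p \<in> fst c" for c p
  proof -
    have "p \<in> sphere 0 1" using p chart_subset_sphere[OF c] by blast
    then have pp: "p \<in> fst c \<inter> fst (c0 p)" using c0 p by blast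
    then have "v 0 (c0 p) (snd (c0 p) p) = frechet_derivative (transition c (c0 p)) (at (snd c p)) (v 0 c (snd c p))"
      using vf c c0(1) unfolding vector_field_def by blast
    then show ?thesis using param_derivative_transition[OF c c0(1) pp] by (simp add: W_def)
  qed
  define g where "g p = covector p \<bullet> (fst (W p), f p)" for p
  have sndW: "snd (W p) = snd p ^ m * f p" if c: "c \<in> stereo_atlas" and p: "p \<in> fst c" for c p
  proof -
    have "(snd \<circ> param c has_derivative snd \<circ> ?D c p) (at (snd c p))"
      using has_derivative_snd[OF param_has_derivative[OF c]] by (simp add: o_def)
    from frechet_derivative_at[OF this, symmetric] show ?thesis
      using df[OF c p] W[OF c p] by simp
  qed
  have "g \<in> smooth_funs stereo_atlas"
    unfolding smooth_funs_def
  proof (intro CollectI ballI)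
    fix c :: "('e \<times> real, 'e) chart" assume c: "c \<in> stereo_atlas"
    have "smooth_on (snd c ` fst c) (v 0 c)" using vf c unfolding vector_field_def by blast
    then have v: "smooth_on UNIV (v 0 c)" unfolding chart_image[OF c] .
    have "smooth_on (snd c ` fst c) (\<lambda>x. f (param c x))"
      using f c unfolding smooth_funs_def o_def by blast
    then have f': "smooth_on UNIV (\<lambda>x. f (param c x))" unfolding chart_image[OF c] .
    have "W (param c x) = frechet_derivative (param c) (at x) (v 0 c x)" for x
      using W[OF c param_in_chart[OF c, of x]] by (simp add: chart_param[OF c])
    then have "g \<circ> param c = (\<lambda>x. covector (param c x) \<bullet>
        (fst (frechet_derivative (param c) (at x) (v 0 c x)), f (param c x)))"
      by (auto simp: g_def)
    moreover have "smooth_on UNIV \<dots>"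
      by (intro smooth_intros smooth_covector smooth_param[OF c] smooth_param_derivative[OF c] v f' open_UNIV)
    ultimately show "smooth_on (snd c ` fst c) (g \<circ> param c)"
      by (simp add: chart_image[OF c])
  qed
  moreover have "g p = contact_form c (snd c p) (\<lambda>i. v i c (snd c p))"
    if "c \<in> stereo_atlas" "p \<in> fst c" "snd p \<noteq> 0" for c p
    using that W[OF that(1,2)] sndW[OF that(1,2)]
    by (simp add: g_def contact_form_def param_chart unanchor_def)
  ultimately show ?thesis unfolding bm_pairing_def by blast
qed

lemma critical_set_height:
  "critical_set (top_of_set (sphere 0 1 :: ('e \<times> real) set)) snd = {p \<in> sphere 0 1. snd p = 0}"
  by (simp add: critical_set_def)

lemma bm_form_contact_form:
  "bm_form (top_of_set (sphere 0 1)) stereo_atlas snd m 1 contact_form"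
proof -
  have "sphere 0 1 - critical_set (top_of_set (sphere 0 1 :: ('e \<times> real) set)) snd =
      sphere 0 1 - {p. snd p = 0}"
    by (auto simp: critical_set_height)
  then show ?thesis
    unfolding bm_form_def using form_on_contact_form contact_form_pairing by simp
qed

section \<open>The contact condition\<close>

text \<open>By transversality, the ambient space is the direct sum of the plane spanned by the Liouville
  and the Reeb vector, which form a hyperbolic pair, and its \<open>\<Omega>\<close>-complement \<open>U\<close>, the
  kernel of \<open>\<alpha>\<close> in the tangent space.  Hence \<open>\<Omega>\<close> is nondegenerate on \<open>U\<close>.\<close>
lemma contact_frame_exists:
  assumes p: "p \<in> sphere 0 1" and dim: "DIM('e) = 2 * n + 1"
  shows "\<exists>w. (\<forall>i. w i \<bullet> normal p = 0) \<and>
    wedge 1 (2 * n) (\<lambda>u. covector p \<bullet> u 0) (wedge_power 2 (\<lambda>u. J (u 0) \<bullet> u 1) n) w > 0"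
proof -
  define B where "B u w = J u \<bullet> w" for u w
  define U where "U = {u. covector p \<bullet> u = 0 \<and> normal p \<bullet> u = 0}"
  note D = liouville_transverse[OF p]
  have bil: "bilinear B"
    unfolding bilinear_def B_def linear_iff by (simp add: J_simps inner_simps)
  have skew: "B u w = - B w u" for u w
    unfolding B_def J_skew[of u w] by (simp add: inner_commute)
  have sub: "subspace U" by (auto simp: U_def subspace_def inner_simps)
  have "dim {covector p, normal p} + dim U = DIM('e \<times> real)"
  proof -
    let ?A = "{covector p, normal p}"
    have "U = {y \<in> UNIV. \<forall>x\<in>span ?A. orthogonal x y}"
    proof (intro equalityI subsetI)
      fix y assume y: "y \<in> U"
      have "orthogonal y x" if "x \<in> span ?A" for x
        by (rule orthogonal_to_span[OF that])
          (use y in \<open>auto simp: U_def orthogonal_def inner_commute\<close>)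
      then show "y \<in> {y \<in> UNIV. \<forall>x\<in>span ?A. orthogonal x y}"
        by (simp add: orthogonal_commute)
    next
      fix y assume "y \<in> {y \<in> UNIV. \<forall>x\<in>span ?A. orthogonal x y}"
      then show "y \<in> U"
        using span_base[of _ ?A] by (simp add: U_def orthogonal_def)
    qed
    then show ?thesis
      using dim_subspace_orthogonal_to_vectors[OF subspace_span subspace_UNIV, of ?A]
      by (simp add: add.commute)
  qed
  moreover have "dim {covector p, normal p} \<le> 2"
    by (rule order_trans[OF dim_le_card']) (auto simp: card_insert_if)
  ultimately have dimU: "2 * n \<le> Suc (dim U)" using dim by simp
  have nondeg: "\<exists>w\<in>U. B u w \<noteq> 0" if u: "u \<in> U" "u \<noteq> 0" for u
  proof -
    \<comment> \<open>\<open>\<Omega>(u, J u) = |u|\<^sup>2\<close>, and \<open>u\<close> is \<open>\<Omega>\<close>-orthogonal to the plane along which \<open>J u\<close> is projected.\<close>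
    define w where "w = J u - ((normal p \<bullet> J u) / (liouville p \<bullet> normal p)) *\<^sub>R liouville p
      - (covector p \<bullet> J u) *\<^sub>R reeb p"
    have "covector p \<bullet> liouville p = 0" by (simp add: J_orthogonal flip: J_liouville)
    moreover have "normal p \<bullet> reeb p = 0" by (simp add: reeb_def J_orthogonal)
    ultimately have "w \<in> U"
      using D covector_reeb[OF p] by (simp add: U_def w_def inner_simps inner_commute)
    moreover have "J u \<bullet> liouville p = 0"
      using u(1) by (simp add: J_skew[of u] J_liouville U_def inner_commute)
    moreover have "J u \<bullet> reeb p = 0"
      using u(1) by (simp add: reeb_def J_isometry U_def inner_commute)
    ultimately show ?thesis
      using u(2) by (intro bexI[of _ w]) (simp_all add: B_def w_def inner_simps J_isometry)
  qed
  obtain v where v: "\<And>i. v i \<in> U" "symplectic_family B n v"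
    using symplectic_family_exists[OF bil skew sub dimU nondeg] by blast
  define w where "w i = (case i of 0 \<Rightarrow> reeb p | Suc j \<Rightarrow> v j)" for i
  have "wedge 1 (2 * n) (\<lambda>u. covector p \<bullet> u 0) (wedge_power 2 (\<lambda>u. B (u 0) (u 1)) n) w > 0"
    by (rule wedge_contact_pos) (use v covector_reeb[OF p] in \<open>auto simp: w_def U_def\<close>)
  moreover have "w i \<bullet> normal p = 0" for i
    using v(1) by (auto simp: w_def U_def reeb_def J_orthogonal inner_commute split: nat.split)
  ultimately show ?thesis unfolding B_def by blast
qed

text \<open>A frame at \<open>p\<close> extends to global \<open>b\<^sup>m\<close>-fields by projecting constant vectors along \<open>normal\<close>.
  The pairing with these fields is computed with smooth coefficients in the \<open>b\<^sup>m\<close>-frame, which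
  treats points on and off the equator alike.\<close>
lemma contact_volume_nonzero:
  assumes p: "p \<in> sphere 0 1" and dim: "DIM('e) = 2 * n + 1"
  shows "bm_nonzero_at stereo_atlas snd m (2 * n + 1) (contact_volume n contact_form) p"
proof -
  let ?vol = "\<lambda>q. wedge 1 (2 * n) (\<lambda>u. covector q \<bullet> u 0) (wedge_power 2 (\<lambda>u. J (u 0) \<bullet> u 1) n)"
  obtain w where w: "\<And>i. w i \<bullet> normal p = 0" "?vol p w > 0"
    using contact_frame_exists[OF assms] by blast
  \<comment> \<open>The orthogonal projection, multiplied by \<open>|normal q|\<^sup>2 / |normal p|\<^sup>2\<close> to keep it polynomial in \<open>q\<close>.\<close>
  define V where "V i q = ((normal q \<bullet> normal q) / (normal p \<bullet> normal p)) *\<^sub>R w i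
      - ((w i \<bullet> normal q) / (normal p \<bullet> normal p)) *\<^sub>R normal q" for i q
  have "normal p \<noteq> 0" using liouville_transverse[OF p] by auto
  then have Vp: "V i p = w i" for i by (simp add: V_def w)
  have tangent: "V i q \<bullet> normal q = 0" for i q by (simp add: V_def inner_simps)
  have smooth: "smooth_on UNIV (\<lambda>x. V i (param c x))"
    if c: "c \<in> stereo_atlas" for i and c :: "('e \<times> real, 'e) chart"
    unfolding V_def using \<open>normal p \<noteq> 0\<close>
    by (intro smooth_intros smooth_normal smooth_param[OF c] open_UNIV) auto
  have bm: "bm_vector_field stereo_atlas snd m (tangent_field (V i))" for i
    by (rule bm_vector_field_tangent_field[OF smooth tangent])
  define g where "g q = ?vol q (\<lambda>i. V i q)" for q
  have "g \<in> smooth_funs stereo_atlas"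
    unfolding smooth_funs_def
  proof (intro CollectI ballI)
    fix c :: "('e \<times> real, 'e) chart" assume c: "c \<in> stereo_atlas"
    have "smooth_on UNIV (\<lambda>x. ?vol (param c x) (\<lambda>i. V i (param c x)))"
      by (intro smooth_on_wedge smooth_on_wedge_power smooth_intros smooth_covector smooth_on_J
          smooth[OF c] smooth_param[OF c] open_UNIV)
    then show "smooth_on (snd c ` fst c) (g \<circ> param c)"
      by (simp add: chart_image[OF c] o_def g_def)
  qed
  moreover have "g q = contact_volume n contact_form c (snd c q) (\<lambda>i. tangent_field (V i) c (snd c q))"
    if c: "c \<in> stereo_atlas" and q: "q \<in> fst c" and z: "snd q \<noteq> 0" for c q
    using z param_derivative_tangent_field[OF c, of "V _" "snd c q"]
    by (subst contact_volume_contact_form[OF c])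
      (simp_all add: g_def param_chart[OF c q] tangent unanchor_anchor)
  ultimately have "bm_pairing stereo_atlas snd (contact_volume n contact_form) (\<lambda>i. tangent_field (V i)) g"
    unfolding bm_pairing_def by blast
  moreover have "g p \<noteq> 0" using w(2) by (simp add: g_def Vp)
  ultimately show ?thesis unfolding bm_nonzero_at_def
    by (intro exI[of _ "\<lambda>i. tangent_field (V i)"] exI[of _ g]) (simp add: bm)
qed

lemma contact_manifold:
  assumes "DIM('e) = 2 * n + 1"
  shows "bm_contact_manifold (top_of_set (sphere 0 1)) stereo_atlas snd m n contact_form"
  unfolding bm_contact_manifold_def
  using assms sphere_smooth_manifold height_defining_function bm_form_contact_form
    contact_volume_nonzero by auto

section \<open>Periodic orbits\<close>

lemma integral_curve_derivative:
  assumes \<gamma>: "integral_curve (top_of_set (sphere 0 1)) stereo_atlas (tangent_field V) \<gamma>"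
    and tangent: "\<And>p. V p \<bullet> normal p = 0"
  shows "(\<gamma> has_vector_derivative anchor (\<gamma> t) (V (\<gamma> t))) (at t)"
proof -
  have cont: "continuous_map euclideanreal (top_of_set (sphere 0 1)) \<gamma>"
    using \<gamma> by (simp add: integral_curve_def)
  then have "\<gamma> t \<in> sphere 0 1" using continuous_map_image_subset_topspace by fastforce
  then obtain c :: "('e \<times> real, 'e) chart" where c: "c \<in> stereo_atlas" and t: "\<gamma> t \<in> fst c"
    unfolding stereo_atlas_cover[symmetric] by blast
  from openin_continuous_map_preimage[OF cont openin_chart[OF c]]
  have op: "open {s. \<gamma> s \<in> fst c}" by simp
  let ?x = "snd c (\<gamma> t)"
  have "((snd c \<circ> \<gamma>) has_vector_derivative tangent_field V c ?x) (at t)"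
    using \<gamma> c t by (simp add: integral_curve_def)
  from vector_derivative_diff_chain_within[OF this, of "param c" "frechet_derivative (param c) (at ?x)"]
  have "((param c \<circ> (snd c \<circ> \<gamma>)) has_vector_derivative
      frechet_derivative (param c) (at ?x) (tangent_field V c ?x)) (at t)"
    using has_derivative_at_withinI[OF param_has_derivative[OF c]] by simp
  then have "((param c \<circ> (snd c \<circ> \<gamma>)) has_vector_derivative anchor (\<gamma> t) (V (\<gamma> t))) (at t)"
    using param_derivative_tangent_field[OF c, of V ?x] tangent by (simp add: param_chart[OF c t])
  then show ?thesis
    by (rule has_vector_derivative_transform_within_open[OF _ op]) (simp_all add: t param_chart[OF c])
qed

text \<open>\<open>dy(R) = \<langle>J \<partial>\<^sub>s, J (normal p)\<rangle> / D = s^(m+1) / D\<close> because \<open>J\<close> is an isometry.  The mean value theorem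
  over one period gives a zero of this rate.\<close>
lemma no_periodic_orbits:
  "\<not> (\<exists>\<gamma>. periodic_orbit_in (top_of_set (sphere 0 1)) stereo_atlas (tangent_field reeb)
     (sphere 0 1 - {p. snd p = 0}) \<gamma>)"
proof
  assume "\<exists>\<gamma>. periodic_orbit_in (top_of_set (sphere 0 1)) stereo_atlas (tangent_field reeb)
     (sphere 0 1 - {p. snd p = 0}) \<gamma>"
  then obtain \<gamma> T where \<gamma>: "integral_curve (top_of_set (sphere 0 1)) stereo_atlas (tangent_field reeb) \<gamma>"
    and off: "\<And>t. \<gamma> t \<in> sphere 0 1" "\<And>t. snd (\<gamma> t) \<noteq> 0" and T: "T > 0" "\<And>t. \<gamma> (t + T) = \<gamma> t"
    unfolding periodic_orbit_in_def by blast
  let ?d = "\<lambda>t. snd (\<gamma> t) ^ (m + 1) / (liouville (\<gamma> t) \<bullet> normal (\<gamma> t))"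
  have "((\<lambda>t. J pole \<bullet> \<gamma> t) has_real_derivative ?d t) (at t)" for t
  proof -
    have "(\<gamma> has_vector_derivative anchor (\<gamma> t) (reeb (\<gamma> t))) (at t)"
      by (rule integral_curve_derivative[OF \<gamma>]) (simp add: reeb_def J_orthogonal)
    then have "((\<lambda>t. J pole \<bullet> \<gamma> t) has_vector_derivative J pole \<bullet> anchor (\<gamma> t) (reeb (\<gamma> t))) (at t)"
      by (rule bounded_linear.has_vector_derivative[OF bounded_linear_inner_right])
    moreover have "J pole \<bullet> anchor q u = J pole \<bullet> u" for q u
      by (simp add: anchor_def inner_prod_def snd_J_pole)
    moreover have "J pole \<bullet> reeb q = snd q ^ (m + 1) / (liouville q \<bullet> normal q)" for q
      by (simp add: reeb_def J_isometry inner_pole normal_def)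
    ultimately show ?thesis by (simp add: has_real_derivative_iff_has_vector_derivative)
  qed
  from MVT2[OF T(1), of _ ?d, OF this]
  obtain t where "J pole \<bullet> \<gamma> T - J pole \<bullet> \<gamma> 0 = (T - 0) * ?d t" by blast
  moreover have "\<gamma> T = \<gamma> 0" using T(2)[of 0] by simp
  moreover have "?d t \<noteq> 0" using off(2)[of t] liouville_transverse[OF off(1)[of t]] by simp
  ultimately show False using T(1) by simp
qed

end

theorem claim6p6:
  fixes m n :: nat
  assumes "m \<ge> 1" and "DIM('e::euclidean_space) = 2 * n + 1"
  shows "\<exists>(M :: ('e \<times> real) topology) (A :: ('e \<times> real, 'e) chart set) z \<alpha> R.
    compact_space M \<and>
    bm_contact_manifold M A z m n \<alpha> \<and>
    critical_set M z \<noteq> {} \<and>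
    reeb_field A z m \<alpha> R \<and>
    \<not> (\<exists>\<gamma>. periodic_orbit_in M A R (topspace M - critical_set M z) \<gamma>)"
proof -
  have dim: "DIM('e \<times> real) = 2 * (n + 1)" using assms(2) by simp
  then obtain J :: "'e \<times> real \<Rightarrow> 'e \<times> real" where
    J: "linear J" "\<And>v. J (J v) = - v" "\<And>v w. J v \<bullet> w = - (v \<bullet> J w)"
    using complex_structure_exists[OF dim] by blast
  interpret bm_contact_sphere J m
    by (intro bm_contact_sphere.intro J assms(1))
  let ?M = "top_of_set (sphere 0 1 :: ('e \<times> real) set)"
  show ?thesis
  proof (intro exI conjI)
    show "compact_space ?M"
      by (simp add: compact_space_subtopology)
    show "bm_contact_manifold ?M stereo_atlas snd m n contact_form"
      by (rule contact_manifold[OF assms(2)])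
    show "reeb_field stereo_atlas snd m contact_form (tangent_field reeb)"
      by (rule reeb_field_reeb)
    obtain b :: 'e where b: "b \<in> Basis" using nonempty_Basis by blast
    have "(b, 0) \<in> sphere (0 :: 'e \<times> real) 1" unfolding in_sphere_iff using b by simp
    then show "critical_set ?M snd \<noteq> {}" unfolding critical_set_height by force
    have "topspace ?M - critical_set ?M snd = sphere 0 1 - {p. snd p = 0}"
      unfolding critical_set_height by auto
    then show "\<not> (\<exists>\<gamma>. periodic_orbit_in ?M stereo_atlas (tangent_field reeb)
        (topspace ?M - critical_set ?M snd) \<gamma>)"
      using no_periodic_orbits by simp
  qed
qed

end
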